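(* Assume $0<T<T_0$. The Feynman--Kac mapping $\mathcal L$ is a contraction on $\mathcal X$: for any $0<\lambda<1$ there exists $\varkappa\ge1$ in the metric $\rho=\rho_\varkappa$ such that for any $h,f\in\mathcal X$, $$\rho(\mathcal L_h,\mathcal L_f)\le\lambda\,\rho(h,f).$$
   Context: Parameters. Fix constants $0<\gamma<1$, $\kappa>0$, $\sigma>0$, $\varpi>0$, $T>0$ and $r\in\mathbb R$ with $r\le\kappa$ and $\kappa_1:=\kappa+r>0$. Put $\gamma_1=\frac{\sigma^2}{1-\gamma}$, $\gamma_2=\frac{\gamma\kappa_1}{1-\gamma}+\kappa$, $\gamma_3=\frac{\gamma\kappa_1^2}{(1-\gamma)\sigma^2}$, $\check\gamma_2=\gamma_2/\gamma_1$, $\check\gamma_3=\gamma_3/\gamma_1$, $\vartheta=\sqrt{\check\gamma_2^2-\check\gamma_3}$, $\omega=2\vartheta\gamma_1$, and $$g(t)=\check\gamma_2-\vartheta-\frac{2\vartheta(\check\gamma_2-\vartheta)}{e^{\omega(T-t)}(\check\gamma_2+\vartheta)-\check\gamma_2+\vartheta},\qquad 0\le t\le T,$$ which solves $g'(t)-2\gamma_2g(t)+\gamma_1g^2(t)+\gamma_3=0$, $g(T)=0$. Put $g_1(t)=\gamma_1g(t)-\gamma_2$, $$\mathbf B_1=\frac1{\gamma_1}\left(\sqrt{\frac{\pi}{2T}}+\sqrt{\frac{|\pi-4T\sigma^2\varpi^{1/(\gamma-1)}|}{2T}}\right),\qquad \mathbf B_0=\Big(q_1+\frac{\gamma_1}{2}\mathbf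 B_1^2\Big)T,\qquad q_1=\frac{g(0)\sigma^2}{2}+r\gamma+(1-\gamma)\varpi^{1/(\gamma-1)},$$ $$T_0=\min\left(\frac{\kappa(1-\gamma)}{2(3+\gamma)\kappa_2},\ \frac{\gamma(1-\gamma)}{(3+\gamma)(\gamma+1)\sigma^2g(0)},\ \frac{\pi}{4\sigma^2}\right),\qquad \kappa_2=\kappa_1^2\Big(\frac1{\sigma^2}+\frac12+\frac{g(0)}{\kappa_1}\Big).$$ Function space. $\mathcal X$ is the set of functions $h:\mathbb R\times[0,T]\to\mathbb R_+=[0,\infty)$, $(s,t)\mapsto h(s,t)$, of class $C^{1,0}$ ($h$ and $h_s=\partial h/\partial s$ are continuous on $\mathbb R\times[0,T]$), with $\sup_{s,t}h(s,t)\le\mathbf B_0$ and $\sup_{s,t}|h_s(s,t)|\le\mathbf B_1$. For a parameter $\varkappa$, $$\rho(f,h)=\rho_\varkappa(f,h)=\sup_{s\in\mathbb R,\ 0\le t\le T}e^{-\varkappa(T-t)}\big(|h(s,t)-f(s,t)|+|h_s(s,t)-f_s(s,t)|\big).$$ Feynman--Kac mapping. For $0\le t\le T$, $s\in\mathbb R$ let $(\eta^{s,t}_u)_{t\le u\le T}$ solve $d\eta^{s,t}_u=g_1(u)\eta^{s,t}_u\,du+\sigma\,d\check W_u$, $\eta^{s,t}_t=s$, where $\check W$ is a standard Brownian motion. For $h\in\mathcal X$ set $$\mathcal L_h(s,t)=\int_t^T\mathbf E\,\Psi_h(\eta^{s,t}_u,u)\,du,$$ $$\Psi_h(s,t)=\frac{\sigma^2h_s(s,t)^2}{2(1-\gamma)}+\frac{\sigma^2g(t)}2+r\gamma+(1-\gamma)\varpi^{-1/(1-\gamma)}G(s,t,h(s,t)),\qquad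 G(s,t,y)=\exp\Big\{-\frac1{1-\gamma}\Big(\frac{s^2}2g(t)+y\Big)\Big\}.$$ *)

theory Defs
  imports "HOL-Probability.Probability"
begin

definition standard_brownian_motion :: "'w measure \<Rightarrow> (real \<Rightarrow> 'w \<Rightarrow> real) \<Rightarrow> bool" where
  "standard_brownian_motion M W \<longleftrightarrow>
     prob_space M \<and>
     (\<forall>t\<ge>0. W t \<in> borel_measurable M) \<and>
     (AE \<omega> in M. W 0 \<omega> = 0) \<and>
     (\<forall>s t. 0 \<le> s \<and> s < t \<longrightarrow>
        distributed M lborel (\<lambda>\<omega>. W t \<omega> - W s \<omega>) (normal_density 0 (sqrt (t - s)))) \<and>
     (\<forall>(n::nat) \<tau>. 0 \<le> \<tau> 0 \<and> (\<forall>i<n. \<tau> i < \<tau> (Suc i)) \<longrightarrow>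
        prob_space.indep_vars M (\<lambda>_. borel) (\<lambda>i \<omega>. W (\<tau> (Suc i)) \<omega> - W (\<tau> i) \<omega>) {..<n}) \<and>
     (AE \<omega> in M. continuous_on {0..} (\<lambda>t. W t \<omega>))"

(* Partial derivative with respect to the first (space) variable. *)
definition d_s :: "(real \<Rightarrow> real \<Rightarrow> real) \<Rightarrow> real \<Rightarrow> real \<Rightarrow> real" where
  "d_s h s t = deriv (\<lambda>x. h x t) s"

(* Functions on \<real> \<times> [0,T] are represented by total functions of (s,t); no notion below
   looks at their values for t outside [0,T]. *)
locale market =
  fixes \<gamma> \<kappa> \<sigma> varpi T r :: real
begin

definition "\<kappa>\<^sub>1 = \<kappa> + r"
definition "\<gamma>\<^sub>1 = \<sigma>\<^sup>2 / (1 - \<gamma>)"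
definition "\<gamma>\<^sub>2 = \<gamma> * \<kappa>\<^sub>1 / (1 - \<gamma>) + \<kappa>"
definition "\<gamma>\<^sub>3 = \<gamma> * \<kappa>\<^sub>1\<^sup>2 / ((1 - \<gamma>) * \<sigma>\<^sup>2)"
definition "c\<gamma>\<^sub>2 = \<gamma>\<^sub>2 / \<gamma>\<^sub>1"
definition "c\<gamma>\<^sub>3 = \<gamma>\<^sub>3 / \<gamma>\<^sub>1"
definition "\<theta> = sqrt (c\<gamma>\<^sub>2\<^sup>2 - c\<gamma>\<^sub>3)"
definition "\<omega> = 2 * \<theta> * \<gamma>\<^sub>1"

definition g :: "real \<Rightarrow> real" where
  "g t = c\<gamma>\<^sub>2 - \<theta> - 2 * \<theta> * (c\<gamma>\<^sub>2 - \<theta>) / (exp (\<omega> * (T - t)) * (c\<gamma>\<^sub>2 + \<theta>) - c\<gamma>\<^sub>2 + \<theta>)"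

definition g\<^sub>1 :: "real \<Rightarrow> real" where
  "g\<^sub>1 t = \<gamma>\<^sub>1 * g t - \<gamma>\<^sub>2"

definition "q\<^sub>1 = g 0 * \<sigma>\<^sup>2 / 2 + r * \<gamma> + (1 - \<gamma>) * varpi powr (1 / (\<gamma> - 1))"
definition "B\<^sub>1 = 1 / \<gamma>\<^sub>1 *
  (sqrt (pi / (2 * T)) + sqrt (\<bar>pi - 4 * T * \<sigma>\<^sup>2 * varpi powr (1 / (\<gamma> - 1))\<bar> / (2 * T)))"
definition "B\<^sub>0 = (q\<^sub>1 + \<gamma>\<^sub>1 / 2 * B\<^sub>1\<^sup>2) * T"

definition "\<kappa>\<^sub>2 = \<kappa>\<^sub>1\<^sup>2 * (1 / \<sigma>\<^sup>2 + 1 / 2 + g 0 / \<kappa>\<^sub>1)"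

(* g, hence also T\<^sub>0, depends on the horizon T. *)
definition "T\<^sub>0 = Min {\<kappa> * (1 - \<gamma>) / (2 * (3 + \<gamma>) * \<kappa>\<^sub>2),
  \<gamma> * (1 - \<gamma>) / ((3 + \<gamma>) * (\<gamma> + 1) * \<sigma>\<^sup>2 * g 0),
  pi / (4 * \<sigma>\<^sup>2)}"

definition C10 :: "(real \<Rightarrow> real \<Rightarrow> real) set" where
  "C10 = {h. (\<forall>s. \<forall>t\<in>{0..T}. (\<lambda>x. h x t) differentiable (at s)) \<and>
             continuous_on (UNIV \<times> {0..T}) (\<lambda>(s, t). h s t) \<and>
             continuous_on (UNIV \<times> {0..T}) (\<lambda>(s, t). d_s h s t)}"

definition X :: "(real \<Rightarrow> real \<Rightarrow> real) set" where
  "X = {h \<in> C10. \<forall>s. \<forall>t\<in>{0..T}. 0 \<le> h s t \<and> h s t \<le> B\<^sub>0 \<and> \<bar>d_s h s t\<bar> \<le> B\<^sub>1}"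

(* Extended-valued, so that the supremum is meaningful without a boundedness proof. *)
definition \<rho> :: "real \<Rightarrow> (real \<Rightarrow> real \<Rightarrow> real) \<Rightarrow> (real \<Rightarrow> real \<Rightarrow> real) \<Rightarrow> ennreal" where
  "\<rho> k f h = (SUP (s, t)\<in>UNIV \<times> {0..T}.
     ennreal (exp (- k * (T - t)) * (\<bar>h s t - f s t\<bar> + \<bar>d_s h s t - d_s f s t\<bar>)))"

(* \<eta> solves d\<eta>_u = g_1(u) \<eta>_u du + \<sigma> dW_u on [t,T], \<eta>_t = s. Since \<sigma> is constant, the
   stochastic integral over [t,u] is the increment \<sigma> (W_u - W_t). *)
definition solves_sde ::
    "'w measure \<Rightarrow> (real \<Rightarrow> 'w \<Rightarrow> real) \<Rightarrow> real \<Rightarrow> real \<Rightarrow> (real \<Rightarrow> 'w \<Rightarrow> real) \<Rightarrow> bool" where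
  "solves_sde M W s t \<eta> \<longleftrightarrow>
     (\<forall>u\<in>{t..T}. \<eta> u \<in> borel_measurable M) \<and>
     (AE w in M. continuous_on {t..T} (\<lambda>u. \<eta> u w) \<and>
        (\<forall>u\<in>{t..T}. \<eta> u w = s + integral {t..u} (\<lambda>v. g\<^sub>1 v * \<eta> v w) + \<sigma> * (W u w - W t w)))"

definition G :: "real \<Rightarrow> real \<Rightarrow> real \<Rightarrow> real" where
  "G s t y = exp (- (1 / (1 - \<gamma>)) * (s\<^sup>2 / 2 * g t + y))"

definition \<Psi> :: "(real \<Rightarrow> real \<Rightarrow> real) \<Rightarrow> real \<Rightarrow> real \<Rightarrow> real" where
  "\<Psi> h s t = \<sigma>\<^sup>2 * (d_s h s t)\<^sup>2 / (2 * (1 - \<gamma>)) + \<sigma>\<^sup>2 * g t / 2 + r * \<gamma>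
     + (1 - \<gamma>) * varpi powr (- 1 / (1 - \<gamma>)) * G s t (h s t)"

(* \<eta> s t is the solution started from s at time t. *)
definition L :: "'w measure \<Rightarrow> (real \<Rightarrow> real \<Rightarrow> real \<Rightarrow> 'w \<Rightarrow> real) \<Rightarrow>
    (real \<Rightarrow> real \<Rightarrow> real) \<Rightarrow> real \<Rightarrow> real \<Rightarrow> real" where
  "L M \<eta> h s t = integral {t..T} (\<lambda>u. \<integral>w. \<Psi> h (\<eta> s t u w) u \<partial>M)"

end

end

theory Submission
  imports Defs
begin

text \<open>
  The mapping is a Duhamel integral \<open>\<integral>\<^sub>t\<^sup>T E \<Psi>\<^sub>h(\<eta>\<^sub>u, u) du\<close> of the reward \<open>\<Psi>\<^sub>h\<close> along a linear
  diffusion. That diffusion is Gaussian: \<open>\<eta>\<^sub>u\<close> has mean \<open>b s\<close> and standard deviation \<open>c\<close> with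
  \<open>b = a t / a u\<close> and \<open>c = \<sigma> sqrt (\<integral>\<^sub>t\<^sup>u a\<^sup>2) / a u\<close>, where \<open>a\<close> is the integrating factor of the
  drift; in particular \<open>c\<close> is at least a constant times \<open>sqrt (u - t)\<close>.

  For the law, the noise is additive, so the equation holds path by path and summation by parts
  turns the solution into a limit of the sums
  \<open>\<Sum> a (t\<^sub>i) (W (t\<^sub>i\<^sub>+\<^sub>1) - W (t\<^sub>i))\<close>
  (\<open>linear_sde_pathwise\<close>). These are normal because the increments are independent, their variances
  are Riemann sums, and bounded convergence passes both facts to the limit
  (\<open>linear_sde_expectation\<close>).

  Gaussian smoothing then differentiates in \<open>s\<close> although \<open>\<Psi>\<^sub>h\<close> is merely continuous: the derivative
  falls on the density, and costs a factor \<open>b / c\<close> of order \<open>1 / sqrt (u - t)\<close>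
  (\<open>has_real_derivative_gauss_average\<close>). As this singularity is integrable, dominated convergence
  shows that the mapping sends the space into the functions of class \<open>C\<^sup>1\<^sup>,\<^sup>0\<close>.

  For the contraction, \<open>\<Psi>\<^sub>h\<close> is Lipschitz in \<open>(h, h\<^sub>s)\<close> on the space, since \<open>h\<^sub>s\<close> is bounded there and
  \<open>G\<close> is Lipschitz in \<open>y \<ge> 0\<close> as \<open>g \<ge> 0\<close>. If \<open>\<rho>\<^sub>k(h, f) = R\<close>, the difference of the rewards at time
  \<open>u\<close> is thus at most a constant times \<open>R exp (k (T - u))\<close>, and integrating it against the two kernels
  gives \<open>\<rho>\<^sub>k(L h, L f) \<le> C R \<integral>\<^sub>0\<^sup>T (1 + 1 / sqrt y) exp (- k y) dy\<close> with \<open>C\<close> independent of \<open>k\<close>.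
  The integral tends to \<open>0\<close> as \<open>k\<close> grows, which yields any prescribed factor.
\<close>

section \<open>Integrals depending on a parameter\<close>

text \<open>The mean value theorem turns the domination of the derivative near \<open>x0\<close> into a domination of the
  difference quotients.\<close>

lemma has_real_derivative_integral_dominated:
  fixes f f' :: "real \<Rightarrow> 'a \<Rightarrow> real"
  assumes "0 < e"
    and int: "\<And>x. \<bar>x - x0\<bar> < e \<Longrightarrow> integrable M (f x)"
    and der: "\<And>x y. \<bar>x - x0\<bar> < e \<Longrightarrow> y \<in> space M \<Longrightarrow>
       ((\<lambda>x. f x y) has_real_derivative f' x y) (at x)"
    and bd: "\<And>x y. \<bar>x - x0\<bar> < e \<Longrightarrow> y \<in> space M \<Longrightarrow> \<bar>f' x y\<bar> \<le> w y"
    and w: "integrable M w" and meas: "f' x0 \<in> borel_measurable M"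
  shows "((\<lambda>x. \<integral>y. f x y \<partial>M) has_real_derivative (\<integral>y. f' x0 y \<partial>M)) (at x0)"
  unfolding has_field_derivative_iff
proof (subst tendsto_at_iff_sequentially, intro allI impI)
  fix X :: "nat \<Rightarrow> real" assume X: "\<forall>i. X i \<in> UNIV - {x0}" and lim: "X \<longlonglongrightarrow> x0"
  have "\<forall>\<^sub>F i in sequentially. \<bar>X i - x0\<bar> < e"
    using tendstoD[OF lim \<open>0 < e\<close>] by (simp add: dist_real_def)
  then obtain m where m: "\<And>i. \<bar>X (i + m) - x0\<bar> < e"
    unfolding eventually_sequentially by (metis le_add2)
  have "(\<lambda>i. \<integral>y. (f (X (i + m)) y - f x0 y) / (X (i + m) - x0) \<partial>M)
      \<longlonglongrightarrow> (\<integral>y. f' x0 y \<partial>M)"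
  proof (rule integral_dominated_convergence[where w = w])
    show "(\<lambda>y. (f (X (i + m)) y - f x0 y) / (X (i + m) - x0)) \<in> borel_measurable M" for i
      using int[OF m[of i]] int[of x0] \<open>0 < e\<close> by (auto simp: borel_measurable_integrable)
    show "AE y in M. (\<lambda>i. (f (X (i + m)) y - f x0 y) / (X (i + m) - x0)) \<longlonglongrightarrow> f' x0 y"
    proof (rule AE_I2)
      fix y assume "y \<in> space M"
      then have "((\<lambda>x. (f x y - f x0 y) / (x - x0)) \<longlongrightarrow> f' x0 y) (at x0)"
        using der[of x0 y] \<open>0 < e\<close> by (simp add: has_field_derivative_iff)
      then have "(\<lambda>i. (f (X i) y - f x0 y) / (X i - x0)) \<longlonglongrightarrow> f' x0 y"
        using X lim unfolding tendsto_at_iff_sequentially by (auto simp: o_def)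
      then show "(\<lambda>i. (f (X (i + m)) y - f x0 y) / (X (i + m) - x0)) \<longlonglongrightarrow> f' x0 y"
        by (rule LIMSEQ_ignore_initial_segment)
    qed
    show "AE y in M. norm ((f (X (i + m)) y - f x0 y) / (X (i + m) - x0)) \<le> w y" for i
    proof (rule AE_I2)
      fix y assume y: "y \<in> space M"
      have "norm (f (X (i + m)) y - f x0 y) \<le> w y * norm (X (i + m) - x0)"
      proof (rule field_differentiable_bound[where S = "{x0 - e<..<x0 + e}" and f' = "\<lambda>x. f' x y"])
        show "((\<lambda>x. f x y) has_field_derivative f' z y) (at z within {x0 - e<..<x0 + e})"
          if "z \<in> {x0 - e<..<x0 + e}" for z
          using der[of z y] that y by (auto intro: has_field_derivative_at_within)
        show "norm (f' z y) \<le> w y" if "z \<in> {x0 - e<..<x0 + e}" for z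
          using bd[of z y] that y by auto
      qed (use m[of i] \<open>0 < e\<close> in auto)
      then show "norm ((f (X (i + m)) y - f x0 y) / (X (i + m) - x0)) \<le> w y"
        using X by (simp add: divide_le_eq norm_divide)
    qed
  qed (use w meas in auto)
  moreover have "(\<integral>y. (f (X (i + m)) y - f x0 y) / (X (i + m) - x0) \<partial>M)
      = ((\<integral>y. f (X (i + m)) y \<partial>M) - (\<integral>y. f x0 y \<partial>M)) / (X (i + m) - x0)" for i
    using int[OF m[of i]] int[of x0] \<open>0 < e\<close>
    by (simp only: integral_divide_zero Bochner_Integration.integral_diff)
  ultimately have "(\<lambda>i. ((\<integral>y. f (X (i + m)) y \<partial>M) - (\<integral>y. f x0 y \<partial>M)) / (X (i + m) - x0))
      \<longlonglongrightarrow> (\<integral>y. f' x0 y \<partial>M)"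
    by (simp only:)
  then show "((\<lambda>x. ((\<integral>y. f x y \<partial>M) - (\<integral>y. f x0 y \<partial>M)) / (x - x0)) \<circ> X)
      \<longlonglongrightarrow> (\<integral>y. f' x0 y \<partial>M)"
    unfolding o_def by (rule LIMSEQ_offset)
qed

section \<open>Averages against the standard Gaussian\<close>

definition std_gauss :: "real measure" where
  "std_gauss = density lborel std_normal_density"

lemma prob_space_std_gauss: "prob_space std_gauss"
  unfolding std_gauss_def by (rule prob_space_normal_density) simp

lemma sets_std_gauss [measurable_cong, simp]: "sets std_gauss = sets borel"
  by (simp add: std_gauss_def)

lemma space_std_gauss [simp]: "space std_gauss = UNIV"
  by (simp add: std_gauss_def)

lemma integral_std_gauss:
  fixes f :: "real \<Rightarrow> real"
  assumes "f \<in> borel_measurable borel"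
  shows "(\<integral>z. f z \<partial>std_gauss) = (\<integral>z. std_normal_density z * f z \<partial>lborel)"
  using assms unfolding std_gauss_def by (subst integral_density) auto

lemma integrable_std_gauss:
  fixes f :: "real \<Rightarrow> real"
  assumes "f \<in> borel_measurable borel"
  shows "integrable std_gauss f \<longleftrightarrow> integrable lborel (\<lambda>z. std_normal_density z * f z)"
  using assms unfolding std_gauss_def by (subst integrable_density) auto

lemma integrable_abs_std_gauss: "integrable std_gauss (\<lambda>z. \<bar>z\<bar>)"
  using integrable_std_normal_moment_abs[of 1] by (simp add: integrable_std_gauss)

lemma integrable_id_std_gauss: "integrable std_gauss (\<lambda>z. z)"
  using integrable_std_normal_moment[of 1] by (simp add: integrable_std_gauss)

text \<open>A change of mean of a Gaussian is a change of density by an exponential factor.\<close>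

lemma std_normal_density_shift:
  "std_normal_density (z - d) = std_normal_density z * exp (d * z - d\<^sup>2 / 2)"
  by (simp add: std_normal_density_def exp_add[symmetric] power2_eq_square field_simps)

lemma integral_std_gauss_shift:
  fixes f :: "real \<Rightarrow> real"
  assumes [measurable]: "f \<in> borel_measurable borel"
  shows "(\<integral>z. f (z + d) \<partial>std_gauss) = (\<integral>z. f z * exp (d * z - d\<^sup>2 / 2) \<partial>std_gauss)"
proof -
  have "(\<integral>z. f (z + d) \<partial>std_gauss) = (\<integral>z. std_normal_density z * f (z + d) \<partial>lborel)"
    by (simp add: integral_std_gauss)
  also have "\<dots> = (\<integral>z. std_normal_density (z - d) * f z \<partial>lborel)"
    by (subst lborel_integral_real_affine[where c = 1 and t = "- d"]) auto
  also have "\<dots> = (\<integral>z. f z * exp (d * z - d\<^sup>2 / 2) \<partial>std_gauss)"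
    by (simp add: integral_std_gauss std_normal_density_shift ac_simps)
  finally show ?thesis .
qed

lemma integrable_exp_std_gauss: "integrable std_gauss (\<lambda>z. exp (d * z))"
proof -
  have "integrable lborel (\<lambda>z. std_normal_density (z - d))"
    using lborel_integrable_real_affine[of "std_normal_density" 1 "- d"] by simp
  then have "integrable lborel (\<lambda>z. std_normal_density (z - d) * exp (d\<^sup>2 / 2))"
    by simp
  then show ?thesis
    by (simp add: std_normal_density_shift integrable_std_gauss exp_diff)
qed

text \<open>No derivative of \<open>\<psi>\<close> is available, so the shift of the mean is moved onto the Gaussian
  weight, which is smooth; this costs the factor \<open>1 / c\<close>.\<close>

lemma has_real_derivative_gauss_average:
  fixes \<psi> :: "real \<Rightarrow> real"
  assumes [measurable]: "\<psi> \<in> borel_measurable borel" and bd: "\<And>x. \<bar>\<psi> x\<bar> \<le> K" and c: "c \<noteq> 0"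
  shows "((\<lambda>m. \<integral>z. \<psi> (m + c * z) \<partial>std_gauss) has_real_derivative
     (\<integral>z. \<psi> (m + c * z) * z \<partial>std_gauss) / c) (at m)"
proof -
  interpret prob_space std_gauss by (rule prob_space_std_gauss)
  define f where "f d z = \<psi> (m + c * z) * exp (d * z - d\<^sup>2 / 2)" for d z
  define f' where "f' d z = \<psi> (m + c * z) * (exp (d * z - d\<^sup>2 / 2) * (z - d))" for d z
  \<comment> \<open>the mean is moved by \<open>c d\<close> with \<open>\<bar>d\<bar> < 1\<close>; one function dominates the kernel and its derivative\<close>
  define w where "w z = 2 * K * (exp (2 * z) + exp (- 2 * z))" for z :: real
  have [measurable]: "f d \<in> borel_measurable borel" "f' d \<in> borel_measurable borel" for d
    unfolding f_def f'_def by measurable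
  have K: "0 \<le> K" using bd[of 0] by simp
  have w: "integrable std_gauss w"
    unfolding w_def using integrable_exp_std_gauss[of 2] integrable_exp_std_gauss[of "-2"] by simp
  have ex: "exp (d * z - d\<^sup>2 / 2) * (\<bar>z\<bar> + 1) \<le> 2 * (exp (2 * z) + exp (- 2 * z))"
    if "\<bar>d\<bar> < 1" for d z :: real
  proof -
    have "d * z \<le> \<bar>d\<bar> * \<bar>z\<bar>" by (metis abs_ge_self abs_mult)
    also have "\<dots> \<le> \<bar>z\<bar>" using that by (simp add: mult_left_le_one_le)
    finally have "exp (d * z - d\<^sup>2 / 2) \<le> exp \<bar>z\<bar>" 
      using zero_le_power2[of d] by (simp only: exp_le_cancel_iff)
    moreover have "\<bar>z\<bar> + 1 \<le> exp \<bar>z\<bar>" using exp_ge_add_one_self[of "\<bar>z\<bar>"] by linarith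
    ultimately have "exp (d * z - d\<^sup>2 / 2) * (\<bar>z\<bar> + 1) \<le> exp \<bar>z\<bar> * exp \<bar>z\<bar>"
      by (intro mult_mono) auto
    also have "\<dots> = exp (2 * \<bar>z\<bar>)" by (simp add: exp_add[symmetric])
    also have "\<dots> \<le> exp (2 * z) + exp (- 2 * z)"
      by (cases "0 \<le> z") (auto simp: add_increasing add_increasing2)
    also have "\<dots> \<le> 2 * (exp (2 * z) + exp (- 2 * z))" by (simp add: add_pos_pos less_imp_le)
    finally show ?thesis .
  qed
  have bf: "\<bar>f d z\<bar> \<le> w z" if "\<bar>d\<bar> < 1" for d z
  proof -
    have "\<bar>f d z\<bar> \<le> K * (exp (d * z - d\<^sup>2 / 2) * (\<bar>z\<bar> + 1))"
      unfolding f_def abs_mult using bd[of "m + c * z"] K by (intro mult_mono) auto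
    also have "\<dots> \<le> K * (2 * (exp (2 * z) + exp (- 2 * z)))"
      by (intro mult_left_mono ex that K)
    finally show ?thesis by (simp add: w_def algebra_simps)
  qed
  have bf': "\<bar>f' d z\<bar> \<le> w z" if "\<bar>d\<bar> < 1" for d z
  proof -
    have "\<bar>f' d z\<bar> \<le> K * (exp (d * z - d\<^sup>2 / 2) * (\<bar>z\<bar> + 1))"
      unfolding f'_def abs_mult using bd[of "m + c * z"] K that
      by (intro mult_mono) auto
    also have "\<dots> \<le> K * (2 * (exp (2 * z) + exp (- 2 * z)))"
      by (intro mult_left_mono ex that K)
    finally show ?thesis by (simp add: w_def algebra_simps)
  qed
  have "((\<lambda>d. \<integral>z. f d z \<partial>std_gauss) has_real_derivative (\<integral>z. f' 0 z \<partial>std_gauss)) (at 0)"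
  proof (rule has_real_derivative_integral_dominated[where e = 1 and w = w])
    show "integrable std_gauss (f x)" if "\<bar>x - 0\<bar> < 1" for x
      using bf[of x] that by (intro Bochner_Integration.integrable_bound[OF w]) (auto intro!: AE_I2 order_trans[OF bf])
    show "((\<lambda>x. f x y) has_real_derivative f' x y) (at x)" for x y
      unfolding f_def f'_def by (auto intro!: derivative_eq_intros simp: power2_eq_square)
  qed (use bf' w in auto)
  also have "(\<lambda>d. \<integral>z. f d z \<partial>std_gauss) = (\<lambda>d. \<integral>z. \<psi> ((m + c * d) + c * z) \<partial>std_gauss)"
  proof
    fix d
    show "(\<integral>z. f d z \<partial>std_gauss) = (\<integral>z. \<psi> ((m + c * d) + c * z) \<partial>std_gauss)"
      using integral_std_gauss_shift[of "\<lambda>z. \<psi> (m + c * z)" d] unfolding f_def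
      by (simp add: algebra_simps)
  qed
  also have "(\<integral>z. f' 0 z \<partial>std_gauss) = (\<integral>z. \<psi> (m + c * z) * z \<partial>std_gauss)"
    by (simp add: f'_def)
  finally have D: "((\<lambda>d. \<integral>z. \<psi> ((m + c * d) + c * z) \<partial>std_gauss) has_real_derivative
      (\<integral>z. \<psi> (m + c * z) * z \<partial>std_gauss)) (at ((m - m) / c))" by simp
  \<comment> \<open>return from the shift \<open>d\<close> to the mean \<open>x = m + c d\<close>\<close>
  have "((\<lambda>x. (x - m) / c) has_real_derivative 1 / c) (at m)"
    using c by (auto intro!: derivative_eq_intros)
  from DERIV_chain2[OF D this] show ?thesis using c by simp
qed

text \<open>Joint continuity in mean, deviation and time, including the degenerate deviation \<open>c = 0\<close>; the
  weight \<open>w\<close> is \<open>1\<close> for the average itself and \<open>z\<close> for its derivative.\<close>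

lemma continuous_gauss_average:
  fixes \<psi> :: "real \<Rightarrow> real \<Rightarrow> real" and w :: "real \<Rightarrow> real"
  assumes cont: "continuous_on UNIV (\<lambda>(x, u). \<psi> x u)" and bd: "\<And>x u. \<bar>\<psi> x u\<bar> \<le> K"
    and w: "integrable std_gauss w"
  shows "continuous_on UNIV (\<lambda>(m, c, u). \<integral>z. \<psi> (m + c * z) u * w z \<partial>std_gauss)"
proof (subst continuous_on_sequentially, safe)
  fix X :: "nat \<Rightarrow> real \<times> real \<times> real" and m c u assume X: "X \<longlonglongrightarrow> (m, c, u)"
  define mn cn un where "mn n = fst (X n)" and "cn n = fst (snd (X n))"
    and "un n = snd (snd (X n))" for n
  have lims: "mn \<longlonglongrightarrow> m" "cn \<longlonglongrightarrow> c" "un \<longlonglongrightarrow> u"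
    unfolding mn_def cn_def un_def using X
    by (auto intro!: tendsto_eq_intros)
  have [measurable]: "w \<in> borel_measurable borel"
    using w by (auto dest: borel_measurable_integrable simp: measurable_def)
  have c1: "continuous_on UNIV (\<lambda>z. \<psi> (m + c * z) u)" for m c u
    by (rule continuous_on_compose2[OF cont, of _ "\<lambda>z. (m + c * z, u)", simplified])
       (intro continuous_intros)
  have [measurable]: "(\<lambda>z. \<psi> (m + c * z) u) \<in> borel_measurable borel" for m c u
    by (rule borel_measurable_continuous_onI) (rule c1)
  have "(\<lambda>n. \<integral>z. \<psi> (mn n + cn n * z) (un n) * w z \<partial>std_gauss)
     \<longlonglongrightarrow> (\<integral>z. \<psi> (m + c * z) u * w z \<partial>std_gauss)"
  proof (rule integral_dominated_convergence[where w = "\<lambda>z. K * \<bar>w z\<bar>"])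
    show "AE z in std_gauss. (\<lambda>n. \<psi> (mn n + cn n * z) (un n) * w z)
        \<longlonglongrightarrow> \<psi> (m + c * z) u * w z"
    proof (intro AE_I2 tendsto_mult_right)
      fix z
      have "(\<lambda>n. (mn n + cn n * z, un n)) \<longlonglongrightarrow> (m + c * z, u)"
        by (intro tendsto_intros lims)
      from continuous_on_tendsto_compose[OF cont this]
      show "(\<lambda>n. \<psi> (mn n + cn n * z) (un n)) \<longlonglongrightarrow> \<psi> (m + c * z) u" by simp
    qed
    show "AE z in std_gauss. norm (\<psi> (mn n + cn n * z) (un n) * w z) \<le> K * \<bar>w z\<bar>" for n
      by (auto simp: abs_mult intro!: mult_right_mono bd)
  qed (use w in auto)
  then show "((\<lambda>(m, c, u). \<integral>z. \<psi> (m + c * z) u * w z \<partial>std_gauss) \<circ> X)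
      \<longlonglongrightarrow> (\<integral>z. \<psi> (m + c * z) u * w z \<partial>std_gauss)"
    by (simp add: o_def case_prod_beta mn_def cn_def un_def)
qed

lemma section_measurable:
  fixes \<psi> :: "real \<Rightarrow> real \<Rightarrow> real"
  assumes "continuous_on UNIV (\<lambda>(x, u). \<psi> x u)"
  shows "(\<lambda>x. \<psi> x u) \<in> borel_measurable borel"
proof (rule borel_measurable_continuous_onI)
  have p: "continuous_on UNIV (\<lambda>x. (x, u))" by (intro continuous_intros)
  show "continuous_on UNIV (\<lambda>x. \<psi> x u)"
    using continuous_on_compose2[OF assms p] by simp
qed

lemma abs_gauss_average_le:
  fixes f w :: "real \<Rightarrow> real"
  assumes [measurable]: "f \<in> borel_measurable borel" and bd: "\<And>x. \<bar>f x\<bar> \<le> K" and w: "integrable std_gauss w"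
  shows "integrable std_gauss (\<lambda>z. f (m + c * z) * w z)"
    and "\<bar>\<integral>z. f (m + c * z) * w z \<partial>std_gauss\<bar> \<le> K * (\<integral>z. \<bar>w z\<bar> \<partial>std_gauss)"
proof -
  have [measurable]: "w \<in> borel_measurable borel"
    using w by (auto dest: borel_measurable_integrable simp: measurable_def)
  show i: "integrable std_gauss (\<lambda>z. f (m + c * z) * w z)"
    by (rule Bochner_Integration.integrable_bound[where f = "\<lambda>z. K * \<bar>w z\<bar>"])
       (use w in \<open>auto simp: abs_mult intro!: AE_I2 mult_mono order_trans[OF bd abs_ge_self]\<close>)
  have "\<bar>\<integral>z. f (m + c * z) * w z \<partial>std_gauss\<bar> \<le> (\<integral>z. \<bar>f (m + c * z) * w z\<bar> \<partial>std_gauss)"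
    using integral_norm_bound[of std_gauss "\<lambda>z. f (m + c * z) * w z"] by simp
  also have "\<dots> \<le> (\<integral>z. K * \<bar>w z\<bar> \<partial>std_gauss)"
    using integrable_abs[OF i] w by (intro integral_mono) (auto simp: abs_mult intro!: mult_right_mono bd)
  finally show "\<bar>\<integral>z. f (m + c * z) * w z \<partial>std_gauss\<bar> \<le> K * (\<integral>z. \<bar>w z\<bar> \<partial>std_gauss)"
    by simp
qed

section \<open>Riemann--Stieltjes sums\<close>

text \<open>The index is \<open>Suc n\<close> so that every partition has at least one cell.\<close>

definition grid :: "real \<Rightarrow> real \<Rightarrow> nat \<Rightarrow> nat \<Rightarrow> real" where
  "grid t u n i = t + real i * ((u - t) / real (Suc n))"

lemma grid_0 [simp]: "grid t u n 0 = t"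
  by (simp add: grid_def)

lemma grid_last [simp]: "grid t u n (Suc n) = u"
  unfolding grid_def by simp

lemma grid_step: "grid t u n (Suc i) - grid t u n i = (u - t) / real (Suc n)"
  by (simp add: grid_def algebra_simps add_divide_distrib diff_divide_distrib)

lemma grid_less: "t < u \<Longrightarrow> grid t u n i < grid t u n (Suc i)"
  using divide_pos_pos[of "u - t" "real (Suc n)"] by (simp flip: grid_step[of t u n i] del: of_nat_Suc)

lemma grid_mem:
  assumes "t < u" "i \<le> Suc n"
  shows "grid t u n i \<in> {t..u}"
proof -
  have "real i * ((u - t) / real (Suc n)) \<le> real (Suc n) * ((u - t) / real (Suc n))"
    using assms by (intro mult_right_mono) auto
  then have "grid t u n i \<le> u" by (simp add: grid_def)
  then show ?thesis using assms by (simp add: grid_def)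
qed

text \<open>The limit is expressed through an antiderivative \<open>H\<close> of \<open>f A'\<close>, so that the error on each
  cell is an increment of \<open>f (\<xi>) A - H\<close> and the mean value theorem bounds it. Right tags arise from summation
  by parts and left tags from the variances, so both are covered.\<close>

lemma stieltjes_sums_tendsto:
  fixes f A A' H :: "real \<Rightarrow> real"
  assumes tu: "t < u" and f: "continuous_on {t..u} f"
    and dA: "\<And>v. v \<in> {t..u} \<Longrightarrow> (A has_real_derivative A' v) (at v within {t..u})"
    and bA: "\<And>v. v \<in> {t..u} \<Longrightarrow> \<bar>A' v\<bar> \<le> K"
    and dH: "\<And>v. v \<in> {t..u} \<Longrightarrow> (H has_real_derivative f v * A' v) (at v within {t..u})"
    and tag: "\<And>n i. i \<le> n \<Longrightarrow> \<xi> n i \<in> {grid t u n i..grid t u n (Suc i)}"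
  shows "(\<lambda>n. \<Sum>i<Suc n. f (\<xi> n i) * (A (grid t u n (Suc i)) - A (grid t u n i)))
     \<longlonglongrightarrow> H u - H t"
proof (rule LIMSEQ_I)
  fix e :: real assume e: "0 < e"
  have K: "0 \<le> K" using bA[of t] tu by force
  \<comment> \<open>the oscillation of \<open>f\<close> on a cell that keeps the total error below \<open>e\<close>; \<open>K + 1\<close> avoids dividing by \<open>0\<close>\<close>
  define q where "q = e / ((K + 1) * (u - t))"
  have q: "0 < q" "q * K * (u - t) < e"
  proof -
    show "0 < q" using e K tu by (simp add: q_def)
    have "q * K * (u - t) < q * (K + 1) * (u - t)" using \<open>0 < q\<close> tu by simp
    also have "\<dots> = e" using K tu by (simp add: q_def)
    finally show "q * K * (u - t) < e" .
  qed
  have "uniformly_continuous_on {t..u} f" using f by (intro compact_uniformly_continuous) auto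
  then obtain d where d: "0 < d"
    and fd: "\<And>x y. x \<in> {t..u} \<Longrightarrow> y \<in> {t..u} \<Longrightarrow> \<bar>x - y\<bar> < d \<Longrightarrow> \<bar>f x - f y\<bar> < q"
    using q(1) unfolding uniformly_continuous_on_def dist_real_def by metis
  obtain m :: nat where m: "(u - t) / d < real m" using reals_Archimedean2 by blast
  show "\<exists>N. \<forall>n\<ge>N. norm ((\<Sum>i<Suc n. f (\<xi> n i) * (A (grid t u n (Suc i)) - A (grid t u n i)))
      - (H u - H t)) < e"
  proof (intro exI allI impI)
    fix n assume "m \<le> n"
    let ?p = "grid t u n"
    have "(u - t) / d < real (Suc n)" using m \<open>m \<le> n\<close> by simp
    then have small: "(u - t) / real (Suc n) < d" using d by (simp add: field_simps)
    have cell: "\<bar>(f (\<xi> n i) * A (?p (Suc i)) - H (?p (Suc i))) - (f (\<xi> n i) * A (?p i) - H (?p i))\<bar>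
        \<le> q * K * ((u - t) / real (Suc n))" if i: "i < Suc n" for i
    proof -
      have sub: "{?p i..?p (Suc i)} \<subseteq> {t..u}"
        using grid_mem[OF tu, of i n] grid_mem[OF tu, of "Suc i" n] i by auto
      have "norm ((f (\<xi> n i) * A (?p (Suc i)) - H (?p (Suc i))) - (f (\<xi> n i) * A (?p i) - H (?p i)))
          \<le> (q * K) * norm (?p (Suc i) - ?p i)"
      proof (rule field_differentiable_bound[where S = "{?p i..?p (Suc i)}"
            and f = "\<lambda>v. f (\<xi> n i) * A v - H v" and f' = "\<lambda>v. (f (\<xi> n i) - f v) * A' v"])
        fix v assume v: "v \<in> {?p i..?p (Suc i)}"
        then have vt: "v \<in> {t..u}" using sub by auto
        have "((\<lambda>v. f (\<xi> n i) * A v - H v) has_real_derivative (f (\<xi> n i) - f v) * A' v)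
            (at v within {t..u})"
          by (auto intro!: derivative_eq_intros dA[OF vt] dH[OF vt] simp: algebra_simps)
        then show "((\<lambda>v. f (\<xi> n i) * A v - H v) has_real_derivative (f (\<xi> n i) - f v) * A' v)
            (at v within {?p i..?p (Suc i)})"
          by (rule has_field_derivative_subset) (rule sub)
        have x: "\<xi> n i \<in> {?p i..?p (Suc i)}" using tag[of i n] i by simp
        have "\<bar>\<xi> n i - v\<bar> \<le> ?p (Suc i) - ?p i" using x v by auto
        then have "\<bar>\<xi> n i - v\<bar> < d" using small grid_step[of t u n i] by linarith
        then have "\<bar>f (\<xi> n i) - f v\<bar> \<le> q" using fd[of "\<xi> n i" v] x vt sub by fastforce
        then show "norm ((f (\<xi> n i) - f v) * A' v) \<le> q * K"
          using bA[OF vt] q(1) by (auto simp: abs_mult intro!: mult_mono)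
      qed (use grid_less[OF tu, of n i] in auto)
      then show ?thesis using grid_step[of t u n i] tu by simp
    qed
    let ?E = "\<Sum>i<Suc n. (f (\<xi> n i) * A (?p (Suc i)) - H (?p (Suc i)))
        - (f (\<xi> n i) * A (?p i) - H (?p i))"
    have "(\<Sum>i<Suc n. f (\<xi> n i) * (A (?p (Suc i)) - A (?p i))) - (H u - H t)
      = (\<Sum>i<Suc n. f (\<xi> n i) * (A (?p (Suc i)) - A (?p i))) - (\<Sum>i<Suc n. H (?p (Suc i)) - H (?p i))"
      using sum_lessThan_telescope[of "\<lambda>i. H (?p i)" "Suc n"] by (simp only: grid_0 grid_last)
    also have "\<dots> = ?E"
      unfolding sum_subtractf[symmetric] by (intro sum.cong) (auto simp: algebra_simps)
    finally have err: "(\<Sum>i<Suc n. f (\<xi> n i) * (A (?p (Suc i)) - A (?p i))) - (H u - H t) = ?E" .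
    have "\<bar>?E\<bar> \<le> (\<Sum>i<Suc n. q * K * ((u - t) / real (Suc n)))"
      by (intro order_trans[OF sum_abs] sum_mono cell) auto
    also have "\<dots> = q * K * (u - t)" 
      by (simp only: sum_constant card_lessThan times_divide_eq_right mult.assoc
          nonzero_mult_div_cancel_left of_nat_neq_0 not_False_eq_True)
    also have "\<dots> < e" by (rule q)
    finally have "\<bar>?E\<bar> < e" .
    then show "norm ((\<Sum>i<Suc n. f (\<xi> n i) * (A (?p (Suc i)) - A (?p i))) - (H u - H t)) < e"
      by (simp only: err real_norm_def)
  qed
qed

section \<open>The law of the linear diffusion\<close>

lemma (in prob_space) integral_normal_rv:
  fixes \<psi> :: "real \<Rightarrow> real"
  assumes "distributed M lborel X (normal_density 0 s)" and "0 < s"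
    and [measurable]: "\<psi> \<in> borel_measurable borel"
  shows "(\<integral>w. \<psi> (X w) \<partial>M) = (\<integral>z. \<psi> (s * z) \<partial>std_gauss)"
proof -
  have "distributed M lborel (\<lambda>x. (X x - 0) / s) std_normal_density"
    using normal_standard_normal_convert[of s X 0] assms by simp
  from distributed_integral[OF this, of "\<lambda>z. \<psi> (s * z)"]
  have "(\<integral>z. std_normal_density z * \<psi> (s * z) \<partial>lborel) = (\<integral>w. \<psi> (X w) \<partial>M)"
    using \<open>0 < s\<close> by simp
  then show ?thesis by (simp add: integral_std_gauss)
qed

lemma brownian_sum_normal:
  fixes a :: "nat \<Rightarrow> real"
  assumes bm: "standard_brownian_motion M W" and "0 \<le> t" "t < u" and a: "\<And>i. a i \<noteq> 0"
  shows "distributed M lborel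
     (\<lambda>w. \<Sum>i<Suc n. a i * (W (grid t u n (Suc i)) w - W (grid t u n i) w))
     (normal_density 0 (sqrt (\<Sum>i<Suc n. (a i)\<^sup>2 * (grid t u n (Suc i) - grid t u n i))))"
proof -
  interpret prob_space M using bm by (simp add: standard_brownian_motion_def)
  let ?p = "grid t u n"
  have p0: "0 \<le> ?p i" for i using assms by (simp add: grid_def)
  have pl: "?p i < ?p (Suc i)" for i using assms by (simp add: grid_less)
  have ind: "indep_vars (\<lambda>_. borel) (\<lambda>i w. W (?p (Suc i)) w - W (?p i) w) {..<Suc n}"
    using bm p0 pl unfolding standard_brownian_motion_def by blast
  have ind': "indep_vars (\<lambda>_. borel) (\<lambda>i w. a i * (W (?p (Suc i)) w - W (?p i) w)) {..<Suc n}"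
    by (rule indep_vars_compose2[OF ind, where Y = "\<lambda>i x. a i * x"]) simp
  have inc: "distributed M lborel (\<lambda>w. W (?p (Suc i)) w - W (?p i) w)
      (normal_density 0 (sqrt (?p (Suc i) - ?p i)))" for i
    using bm p0 pl unfolding standard_brownian_motion_def by blast
  have "distributed M lborel (\<lambda>w. a i * (W (?p (Suc i)) w - W (?p i) w))
      (normal_density 0 (\<bar>a i\<bar> * sqrt (?p (Suc i) - ?p i)))" for i
    using normal_density_affine[OF inc[of i] _ a[of i], of 0] pl[of i] by simp
  from sum_indep_normal[OF _ _ ind' _ this]
  have "distributed M lborel (\<lambda>w. \<Sum>i<Suc n. a i * (W (?p (Suc i)) w - W (?p i) w))
     (normal_density (\<Sum>i<Suc n. 0) (sqrt (\<Sum>i<Suc n. (\<bar>a i\<bar> * sqrt (?p (Suc i) - ?p i))\<^sup>2)))"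
    using a pl by auto
  also have "(\<Sum>i<Suc n. (\<bar>a i\<bar> * sqrt (?p (Suc i) - ?p i))\<^sup>2)
     = (\<Sum>i<Suc n. (a i)\<^sup>2 * (?p (Suc i) - ?p i))"
    using pl by (intro sum.cong) (auto simp: power_mult_distrib less_imp_le)
  finally show ?thesis by simp
qed

text \<open>Here \<open>x\<close> is a path of the solution and \<open>b\<close> one of the driving motion, which is only continuous.
  Removing the noise leaves a \<open>C\<^sup>1\<close> function \<open>I\<close> with \<open>(a I)' = - s a' (b - b t)\<close>, and
  summation by parts makes the smooth function \<open>a\<close> the integrator in place of the path.\<close>

lemma linear_sde_pathwise:
  fixes a \<beta> x b :: "real \<Rightarrow> real"
  assumes tu: "t < u" and s: "0 < s"
    and da: "\<And>v. v \<in> {t..u} \<Longrightarrow> (a has_real_derivative - \<beta> v * a v) (at v within {t..u})"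
    and \<beta>: "continuous_on {t..u} \<beta>" and b: "continuous_on {t..u} b" and x: "continuous_on {t..u} x"
    and eq: "\<And>v. v \<in> {t..u} \<Longrightarrow> x v = x0 + integral {t..v} (\<lambda>y. \<beta> y * x y) + s * (b v - b t)"
  shows "(\<lambda>n. \<Sum>i<Suc n. a (grid t u n i) * (b (grid t u n (Suc i)) - b (grid t u n i)))
     \<longlonglongrightarrow> (a u * x u - a t * x0) / s"
proof -
  have ca: "continuous_on {t..u} a"
    by (rule DERIV_continuous_on) (rule da)
  have "compact ((\<lambda>v. - \<beta> v * a v) ` {t..u})"
    by (intro compact_continuous_image continuous_intros ca \<beta>) auto
  then obtain K where K: "\<And>v. v \<in> {t..u} \<Longrightarrow> \<bar>- \<beta> v * a v\<bar> \<le> K"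
    by (fastforce simp: bounded_iff dest!: compact_imp_bounded)
  define I where "I v = x0 + integral {t..v} (\<lambda>y. \<beta> y * x y)" for v
  have dI: "(I has_real_derivative \<beta> v * x v) (at v within {t..u})" if "v \<in> {t..u}" for v
    unfolding I_def using that \<beta> x
    by (auto intro!: derivative_eq_intros integral_has_real_derivative continuous_intros)
  have xI: "x v = I v + s * (b v - b t)" if "v \<in> {t..u}" for v
    using eq[OF that] by (simp add: I_def)
  have "(\<lambda>n. \<Sum>i<Suc n. (b (grid t u n (Suc i)) - b t) * (a (grid t u n (Suc i)) - a (grid t u n i)))
     \<longlonglongrightarrow> - (a u * I u) / s - - (a t * I t) / s"
  proof (rule stieltjes_sums_tendsto[OF tu, where f = "\<lambda>v. b v - b t" and H = "\<lambda>v. - (a v * I v) / s"])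
    show "continuous_on {t..u} (\<lambda>v. b v - b t)" by (intro continuous_intros b)
    show "((\<lambda>v. - (a v * I v) / s) has_real_derivative (b v - b t) * (- \<beta> v * a v)) (at v within {t..u})"
      if v: "v \<in> {t..u}" for v
    proof -
      have "((\<lambda>v. - (a v * I v) / s) has_real_derivative
          - ((- \<beta> v * a v) * I v + (\<beta> v * x v) * a v) / s) (at v within {t..u})"
        by (intro DERIV_cdivide DERIV_minus DERIV_mult da dI v)
      also have "- ((- \<beta> v * a v) * I v + (\<beta> v * x v) * a v) / s
          = (b v - b t) * (- \<beta> v * a v)"
        using s by (simp add: xI[OF v] divide_eq_eq) (simp add: algebra_simps)
      finally show ?thesis .
    qed
    show "grid t u n (Suc i) \<in> {grid t u n i..grid t u n (Suc i)}" for n i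
      using grid_less[OF tu, of n i] by simp
  qed (use da K in auto)
  then have lim: "(\<lambda>n. a u * (b u - b t) - (\<Sum>i<Suc n. (b (grid t u n (Suc i)) - b t)
       * (a (grid t u n (Suc i)) - a (grid t u n i))))
     \<longlonglongrightarrow> a u * (b u - b t) - (- (a u * I u) / s - - (a t * I t) / s)"
    by (intro tendsto_intros)
  have parts: "a u * (b u - b t) - (\<Sum>i<Suc n. (b (grid t u n (Suc i)) - b t)
       * (a (grid t u n (Suc i)) - a (grid t u n i)))
     = (\<Sum>i<Suc n. a (grid t u n i) * (b (grid t u n (Suc i)) - b (grid t u n i)))" for n
  proof -
    let ?p = "grid t u n"
    have "a u * (b u - b t) = (\<Sum>i<Suc n. a (?p (Suc i)) * (b (?p (Suc i)) - b t) - a (?p i) * (b (?p i) - b t))"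
      using sum_lessThan_telescope[of "\<lambda>i. a (?p i) * (b (?p i) - b t)" "Suc n"]
      by (simp only: grid_0 grid_last) simp
    then show ?thesis
      by (simp only: sum_subtractf[symmetric]) (intro sum.cong, auto simp: algebra_simps)
  qed
  have "a u * (b u - b t) - (- (a u * I u) / s - - (a t * I t) / s) = (a u * x u - a t * x0) / s"
    using s tu by (simp add: xI I_def field_simps)
  then show ?thesis using lim by (simp only: parts)
qed

text \<open>Expectations along the approximating sums converge in two ways: along paths to the solution, and
  by their explicit normal law to the Gaussian with the limiting variance \<open>V u - V t\<close>.\<close>

lemma linear_sde_expectation:
  fixes a \<beta> V \<psi> :: "real \<Rightarrow> real"
  assumes bm: "standard_brownian_motion M W" and t0: "0 \<le> t" and tu: "t < u" and s: "0 < s"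
    and a: "\<And>v. 0 < a v"
    and da: "\<And>v. v \<in> {t..u} \<Longrightarrow> (a has_real_derivative - \<beta> v * a v) (at v within {t..u})"
    and \<beta>: "continuous_on {t..u} \<beta>"
    and dV: "\<And>v. v \<in> {t..u} \<Longrightarrow> (V has_real_derivative (a v)\<^sup>2) (at v within {t..u})"
    and meas [measurable]: "x u \<in> borel_measurable M"
    and sol: "AE w in M. continuous_on {t..u} (\<lambda>v. x v w) \<and>
       (\<forall>v\<in>{t..u}. x v w = x0 + integral {t..v} (\<lambda>y. \<beta> y * x y w) + s * (W v w - W t w))"
    and \<psi>: "continuous_on UNIV \<psi>" and bd: "\<And>y. \<bar>\<psi> y\<bar> \<le> K"
  shows "(\<integral>w. \<psi> (x u w) \<partial>M) =
     (\<integral>z. \<psi> (a t / a u * x0 + s * sqrt (V u - V t) / a u * z) \<partial>std_gauss)"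
proof -
  interpret prob_space M using bm by (simp add: standard_brownian_motion_def)
  interpret N: prob_space std_gauss by (rule prob_space_std_gauss)
  have [measurable]: "\<psi> \<in> borel_measurable borel"
    by (rule borel_measurable_continuous_onI) (rule \<psi>)
  define S where "S n w = (\<Sum>i<Suc n. a (grid t u n i) * (W (grid t u n (Suc i)) w - W (grid t u n i) w))" for n w
  define v where "v n = (\<Sum>i<Suc n. (a (grid t u n i))\<^sup>2 * (grid t u n (Suc i) - grid t u n i))" for n
  have vpos: "0 < v n" for n
    unfolding v_def using a grid_less[OF tu] by (intro sum_pos mult_pos_pos zero_less_power) auto
  have S: "distributed M lborel (S n) (normal_density 0 (sqrt (v n)))" for n
    unfolding S_def v_def using a by (intro brownian_sum_normal bm t0 tu) (metis less_irrefl)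
  have [measurable]: "S n \<in> borel_measurable M" for n
    using distributed_measurable[OF S] by simp
  have law: "(\<integral>w. \<psi> ((a t * x0 + s * S n w) / a u) \<partial>M)
     = (\<integral>z. \<psi> ((a t * x0 + s * (sqrt (v n) * z)) / a u) \<partial>std_gauss)" for n
    using vpos by (intro integral_normal_rv[OF S, where \<psi> = "\<lambda>y. \<psi> ((a t * x0 + s * y) / a u)"]) auto
  have path: "AE w in M. (\<lambda>n. S n w) \<longlonglongrightarrow> (a u * x u w - a t * x0) / s"
  proof -
    have "AE w in M. continuous_on {0..} (\<lambda>t. W t w)"
      using bm by (simp add: standard_brownian_motion_def)
    with sol show ?thesis
    proof eventually_elim
      case (elim w)
      have "continuous_on {t..u} (\<lambda>v. W v w)"
        using elim(2) by (rule continuous_on_subset) (use t0 in auto)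
      with elim(1) show ?case
        unfolding S_def by (intro linear_sde_pathwise[OF tu s da \<beta>]) auto
    qed
  qed
  have ca: "continuous_on {t..u} a"
    by (rule DERIV_continuous_on) (rule da)
  have v: "v \<longlonglongrightarrow> V u - V t"
    unfolding v_def
    using stieltjes_sums_tendsto[OF tu, where f = "\<lambda>y. (a y)\<^sup>2" and A = "\<lambda>y. y" and A' = "\<lambda>_. 1"
        and K = 1 and H = V and \<xi> = "grid t u"] dV grid_less[OF tu]
    by (auto intro!: continuous_intros ca less_imp_le)
  have "(\<lambda>n. \<integral>w. \<psi> ((a t * x0 + s * S n w) / a u) \<partial>M) \<longlonglongrightarrow> (\<integral>w. \<psi> (x u w) \<partial>M)"
  proof (rule integral_dominated_convergence[where w = "\<lambda>_. K"])
    show "AE w in M. (\<lambda>n. \<psi> ((a t * x0 + s * S n w) / a u)) \<longlonglongrightarrow> \<psi> (x u w)"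
      using path
    proof eventually_elim
      case (elim w)
      have "(\<lambda>n. (a t * x0 + s * S n w) / a u)
          \<longlonglongrightarrow> (a t * x0 + s * ((a u * x u w - a t * x0) / s)) / a u"
        using a[of u] by (intro tendsto_intros elim) auto
      also have "(a t * x0 + s * ((a u * x u w - a t * x0) / s)) / a u = x u w"
        using s a[of u] by (simp add: field_simps)
      finally show ?case
        by (rule continuous_on_tendsto_compose[OF \<psi>]) auto
    qed
  qed (use bd in auto)
  moreover have "(\<lambda>n. \<integral>w. \<psi> ((a t * x0 + s * S n w) / a u) \<partial>M)
     \<longlonglongrightarrow> (\<integral>z. \<psi> ((a t * x0 + s * (sqrt (V u - V t) * z)) / a u) \<partial>std_gauss)"
    unfolding law
  proof (rule integral_dominated_convergence[where w = "\<lambda>_. K"])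
    show "AE z in std_gauss. (\<lambda>n. \<psi> ((a t * x0 + s * (sqrt (v n) * z)) / a u))
       \<longlonglongrightarrow> \<psi> ((a t * x0 + s * (sqrt (V u - V t) * z)) / a u)"
      using a[of u] by (intro AE_I2 continuous_on_tendsto_compose[OF \<psi>] tendsto_intros v) auto
  qed (use bd in auto)
  ultimately have "(\<integral>w. \<psi> (x u w) \<partial>M)
      = (\<integral>z. \<psi> ((a t * x0 + s * (sqrt (V u - V t) * z)) / a u) \<partial>std_gauss)"
    by (rule LIMSEQ_unique)
  then show ?thesis by (simp add: add_divide_distrib mult.assoc)
qed

section \<open>The Feynman--Kac potential of a Gaussian flow\<close>

text \<open>Both kernels that occur below, \<open>1\<close> and \<open>b / c\<close>, are dominated by a multiple of this function of
  the elapsed time.\<close>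

lemma integrable_inverse_sqrt:
  "integrable lborel (\<lambda>y. indicator {0<..T} y * (1 + 1 / sqrt y))"
proof (cases "0 \<le> T")
  case True
  have "(\<lambda>y. y powr (- 1/2)) integrable_on {0<..T}"
    using True by (intro integrable_on_powr_from_0') auto
  then have "(\<lambda>y. y powr (- 1/2)) absolutely_integrable_on {0<..T}"
    by (rule nonnegative_absolutely_integrable_1) auto
  then have "integrable lborel (\<lambda>y. indicator {0<..T} y *\<^sub>R y powr (- 1/2))"
    unfolding set_integrable_def by (subst (asm) integrable_completion) auto
  moreover have "integrable lborel (\<lambda>y. indicator {0<..T} y :: real)"
    by (intro integrable_real_indicator) (auto simp: True)
  ultimately have "integrable lborel (\<lambda>y. indicator {0<..T} y + indicator {0<..T} y *\<^sub>R y powr (- 1/2))"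
    by (intro Bochner_Integration.integrable_add)
  also have "(\<lambda>y. indicator {0<..T} y + indicator {0<..T} y *\<^sub>R y powr (- 1/2))
     = (\<lambda>y. indicator {0<..T} y * (1 + 1 / sqrt y))"
    by (auto simp: fun_eq_iff powr_minus_divide powr_half_sqrt split: split_indicator)
  finally show ?thesis .
qed simp

text \<open>The exponential weight in the metric makes the contraction factor as small as desired: the
  singularity \<open>1 / sqrt y\<close> caused by differentiation in space is integrable, so dominated
  convergence applies as the weight grows.\<close>

lemma weighted_inverse_sqrt_tendsto_0:
  "(\<lambda>n. \<integral>y. indicator {0<..T} y * ((1 + 1 / sqrt y) * exp (- real n * y)) \<partial>lborel)
     \<longlonglongrightarrow> 0"
proof -
  have "(\<lambda>n. \<integral>y. indicator {0<..T} y * ((1 + 1 / sqrt y) * exp (- real n * y)) \<partial>lborel)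
     \<longlonglongrightarrow> (\<integral>y. 0 \<partial>(lborel :: real measure))"
  proof (rule integral_dominated_convergence[OF _ _ integrable_inverse_sqrt[of T]])
    show "AE y in lborel. (\<lambda>n. indicator {0<..T} y * ((1 + 1 / sqrt y) * exp (- real n * y)))
      \<longlonglongrightarrow> (0::real)"
    proof (intro AE_I2)
      fix y :: real
      show "(\<lambda>n. indicator {0<..T} y * ((1 + 1 / sqrt y) * exp (- real n * y))) \<longlonglongrightarrow> (0::real)"
      proof (cases "0 < y")
        case True
        then have "(\<lambda>n. exp (- y) ^ n) \<longlonglongrightarrow> 0" by (intro LIMSEQ_realpow_zero) auto
        then have "(\<lambda>n. exp (- real n * y)) \<longlonglongrightarrow> 0"
          by (simp add: exp_of_nat_mult[symmetric])
        then show ?thesis by (intro tendsto_mult_right_zero)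
      qed simp
    qed
    show "AE y in lborel. norm (indicator {0<..T} y * ((1 + 1 / sqrt y) * exp (- real n * y)) :: real)
        \<le> indicator {0<..T} y * (1 + 1 / sqrt y)" for n
      by (intro AE_I2) (auto simp: abs_mult mult_left_le split: split_indicator)
  qed auto
  then show ?thesis by simp
qed

text \<open>The mean and the deviation of the flow are \<open>b t u * s\<close> and \<open>c t u\<close>. Continuity on
  the whole plane lets them be composed freely; the coefficients of the market are extended to it.\<close>

locale gaussian_flow =
  fixes b c :: "real \<Rightarrow> real \<Rightarrow> real" and T :: real
  assumes b_cont: "continuous_on UNIV (\<lambda>(t, u). b t u)"
    and c_cont: "continuous_on UNIV (\<lambda>(t, u). c t u)"
begin

definition average :: "(real \<Rightarrow> real) \<Rightarrow> (real \<Rightarrow> real \<Rightarrow> real) \<Rightarrow> real \<Rightarrow> real \<Rightarrow> real \<Rightarrow> real" where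
  "average w \<psi> s t y = (\<integral>z. \<psi> (b t (t + y) * s + c t (t + y) * z) (t + y) * w z \<partial>std_gauss)"

text \<open>The time integral is taken over the elapsed time \<open>y = u - t\<close>, so that the singularity of the
  factor \<open>\<beta>\<close> stays at \<open>y = 0\<close> and one dominating function serves for all \<open>t\<close>. The potential itself
  has \<open>\<beta> = w = 1\<close>, its space derivative \<open>\<beta> = b / c\<close> and \<open>w z = z\<close>.\<close>

definition potential :: "(real \<Rightarrow> real \<Rightarrow> real) \<Rightarrow> (real \<Rightarrow> real) \<Rightarrow> (real \<Rightarrow> real \<Rightarrow> real) \<Rightarrow> real \<Rightarrow> real \<Rightarrow> real" where
  "potential \<beta> w \<psi> s t = (\<integral>y. indicator {0<..T - t} y * (\<beta> t (t + y) * average w \<psi> s t y) \<partial>lborel)"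

text \<open>The kernel may be singular at elapsed time \<open>0\<close>; the summand \<open>1\<close> in the bound lets the constant kernel be treated together with \<open>b / c\<close>.\<close>

definition admissible :: "real \<Rightarrow> (real \<Rightarrow> real \<Rightarrow> real) \<Rightarrow> bool" where
  "admissible B \<beta> \<longleftrightarrow> 0 \<le> B \<and> (\<forall>t. \<beta> t \<in> borel_measurable borel) \<and>
     (\<forall>t u. 0 \<le> t \<and> t < u \<and> u \<le> T \<longrightarrow> isCont (\<lambda>(t, u). \<beta> t u) (t, u) \<and>
        \<bar>\<beta> t u\<bar> \<le> B * (1 + 1 / sqrt (u - t)))"

definition bounded_cont :: "real \<Rightarrow> (real \<Rightarrow> real \<Rightarrow> real) \<Rightarrow> bool" where
  "bounded_cont K \<psi> \<longleftrightarrow> continuous_on UNIV (\<lambda>(x, u). \<psi> x u) \<and> (\<forall>x u. \<bar>\<psi> x u\<bar> \<le> K)"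

lemma average_continuous:
  assumes "bounded_cont K \<psi>" and w: "integrable std_gauss w"
  shows "continuous_on UNIV (\<lambda>(s, t, y). average w \<psi> s t y)"
proof -
  have c: "continuous_on UNIV (\<lambda>(m, c, u). \<integral>z. \<psi> (m + c * z) u * w z \<partial>std_gauss)"
    using assms by (intro continuous_gauss_average[where K = K]) (auto simp: bounded_cont_def)
  have sh: "continuous_on UNIV (\<lambda>p :: real \<times> real \<times> real. (fst (snd p), fst (snd p) + snd (snd p)))"
    by (intro continuous_intros)
  have b': "continuous_on UNIV (\<lambda>(s :: real, t, y). b t (t + y))"
    using continuous_on_compose2[OF b_cont sh] by (simp add: case_prod_beta)
  have c': "continuous_on UNIV (\<lambda>(s :: real, t, y). c t (t + y))"
    using continuous_on_compose2[OF c_cont sh] by (simp add: case_prod_beta)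
  have "continuous_on UNIV (\<lambda>(s, t, y). (b t (t + y) * s, c t (t + y), t + y))"
    using b' c' by (auto simp: case_prod_beta intro!: continuous_intros)
  from continuous_on_compose2[OF c this] show ?thesis
    by (simp add: average_def case_prod_beta)
qed

lemma average_measurable:
  assumes "bounded_cont K \<psi>" and "integrable std_gauss w"
  shows "average w \<psi> s t \<in> borel_measurable borel"
proof (rule borel_measurable_continuous_onI)
  have p: "continuous_on UNIV (\<lambda>y. (s, t, y))" by (intro continuous_intros)
  show "continuous_on UNIV (average w \<psi> s t)"
    using continuous_on_compose2[OF average_continuous[OF assms] p] by simp
qed

lemma abs_average_le:
  assumes "bounded_cont K \<psi>" and w: "integrable std_gauss w"
    and bd: "\<And>x. \<bar>\<psi> x (t + y)\<bar> \<le> R"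
  shows "\<bar>average w \<psi> s t y\<bar> \<le> R * (\<integral>z. \<bar>w z\<bar> \<partial>std_gauss)"
  unfolding average_def
  using assms section_measurable[of \<psi> "t + y"]
  by (intro abs_gauss_average_le(2)) (auto simp: bounded_cont_def)

lemma abs_integrand_le:
  assumes \<beta>: "admissible B \<beta>" and \<psi>: "bounded_cont K \<psi>" and w: "integrable std_gauss w"
    and bd: "\<And>x. 0 < y \<Longrightarrow> y \<le> T - t \<Longrightarrow> \<bar>\<psi> x (t + y)\<bar> \<le> R" and R: "0 \<le> R" and t: "0 \<le> t"
  shows "\<bar>indicator {0<..T - t} y * (\<beta> t (t + y) * average w \<psi> s t y)\<bar>
     \<le> indicator {0<..T} y * (1 + 1 / sqrt y) * (B * (R * (\<integral>z. \<bar>w z\<bar> \<partial>std_gauss)))"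
proof (cases "0 < y \<and> y \<le> T - t")
  case True
  have "\<bar>\<beta> t (t + y)\<bar> \<le> B * (1 + 1 / sqrt y)"
    using \<beta> True t add_less_cancel_left[of t 0 y] unfolding admissible_def
    by (metis add.commute add_diff_cancel_left' add_0_right le_diff_eq)
  moreover have "\<bar>average w \<psi> s t y\<bar> \<le> R * (\<integral>z. \<bar>w z\<bar> \<partial>std_gauss)"
    using True by (intro abs_average_le[OF \<psi> w] bd) auto
  ultimately have "\<bar>\<beta> t (t + y) * average w \<psi> s t y\<bar>
      \<le> (B * (1 + 1 / sqrt y)) * (R * (\<integral>z. \<bar>w z\<bar> \<partial>std_gauss))"
    unfolding abs_mult using \<beta> True by (intro mult_mono) (auto simp: admissible_def)
  then show ?thesis using True t by (simp add: mult_ac)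
next
  case False
  have "0 \<le> B" using \<beta> by (simp add: admissible_def)
  then show ?thesis using False R by (auto simp: indicator_def)
qed

lemma integrand_measurable:
  assumes "admissible B \<beta>" "bounded_cont K \<psi>" "integrable std_gauss w"
  shows "(\<lambda>y. indicator {0<..T - t} y * (\<beta> t (t + y) * average w \<psi> s t y)) \<in> borel_measurable borel"
proof -
  have [measurable]: "\<beta> t \<in> borel_measurable borel" using assms by (simp add: admissible_def)
  note average_measurable[OF assms(2,3), measurable]
  show ?thesis by measurable
qed

lemma integrand_integrable:
  assumes \<beta>: "admissible B \<beta>" and \<psi>: "bounded_cont K \<psi>" and w: "integrable std_gauss w" and t: "0 \<le> t"
  shows "integrable lborel (\<lambda>y. indicator {0<..T - t} y * (\<beta> t (t + y) * average w \<psi> s t y))"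
proof (rule Bochner_Integration.integrable_bound)
  show "integrable lborel (\<lambda>y. indicator {0<..T} y * (1 + 1 / sqrt y) * (B * (K * (\<integral>z. \<bar>w z\<bar> \<partial>std_gauss))))"
    using integrable_inverse_sqrt by (rule integrable_mult_left)
  have K: "\<bar>\<psi> x u\<bar> \<le> K" "0 \<le> K" for x u
    using \<psi> order_trans[OF abs_ge_zero, of "\<psi> 0 0" K] by (auto simp: bounded_cont_def)
  show "AE y in lborel. norm (indicator {0<..T - t} y * (\<beta> t (t + y) * average w \<psi> s t y))
      \<le> norm (indicator {0<..T} y * (1 + 1 / sqrt y) * (B * (K * (\<integral>z. \<bar>w z\<bar> \<partial>std_gauss))))"
    using abs_integrand_le[OF \<beta> \<psi> w K(1) K(2) t] by (auto intro!: AE_I2 order_trans[OF _ abs_ge_self])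
qed (use integrand_measurable[OF \<beta> \<psi> w] in simp)

text \<open>The contraction estimate is reduced to a bound for a single integrand.\<close>

lemma potential_diff:
  assumes \<beta>: "admissible B \<beta>" and \<psi>: "bounded_cont K \<psi>" "bounded_cont K' \<psi>'"
    and w: "integrable std_gauss w" and t: "0 \<le> t"
  shows "potential \<beta> w \<psi> s t - potential \<beta> w \<psi>' s t = potential \<beta> w (\<lambda>x u. \<psi> x u - \<psi>' x u) s t"
proof -
  have i: "integrable std_gauss (\<lambda>z. \<psi> (m + c * z) u * w z)" if "bounded_cont K \<psi>" for \<psi> K m c u
    using that section_measurable[of \<psi> u] w
    by (intro abs_gauss_average_le(1)[where K = K]) (auto simp: bounded_cont_def)
  have "average w (\<lambda>x u. \<psi> x u - \<psi>' x u) s t y = average w \<psi> s t y - average w \<psi>' s t y" for y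
    unfolding average_def left_diff_distrib
    by (intro Bochner_Integration.integral_diff i[OF \<psi>(1)] i[OF \<psi>(2)])
  then show ?thesis
    using Bochner_Integration.integral_diff[OF integrand_integrable[OF \<beta> \<psi>(1) w t, of s]
        integrand_integrable[OF \<beta> \<psi>(2) w t, of s]]
    unfolding potential_def by (simp only: right_diff_distrib)
qed

text \<open>The factor \<open>exp (k (T - t))\<close> reproduces the weight of the metric, and what remains of the exponential
  in the integrand is \<open>exp (- k y)\<close> with \<open>y\<close> the elapsed time.\<close>

lemma abs_potential_le:
  assumes \<beta>: "admissible B \<beta>" and \<psi>: "bounded_cont K \<psi>" and w: "integrable std_gauss w"
    and bd: "\<And>x u. u \<in> {0..T} \<Longrightarrow> \<bar>\<psi> x u\<bar> \<le> R * exp (k * (T - u))" and R: "0 \<le> R" and t: "0 \<le> t"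
  shows "\<bar>potential \<beta> w \<psi> s t\<bar> \<le> B * (\<integral>z. \<bar>w z\<bar> \<partial>std_gauss) * R * exp (k * (T - t)) *
     (\<integral>y. indicator {0<..T} y * ((1 + 1 / sqrt y) * exp (- k * y)) \<partial>lborel)"
proof -
  let ?C = "B * (\<integral>z. \<bar>w z\<bar> \<partial>std_gauss) * R * exp (k * (T - t))"
  have le: "\<bar>indicator {0<..T - t} y * (\<beta> t (t + y) * average w \<psi> s t y)\<bar>
     \<le> ?C * (indicator {0<..T} y * ((1 + 1 / sqrt y) * exp (- k * y)))" for y
  proof -
    have "\<bar>indicator {0<..T - t} y * (\<beta> t (t + y) * average w \<psi> s t y)\<bar>
     \<le> indicator {0<..T} y * (1 + 1 / sqrt y) *
        (B * ((R * exp (k * (T - (t + y)))) * (\<integral>z. \<bar>w z\<bar> \<partial>std_gauss)))"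
      using R t by (intro abs_integrand_le[OF \<beta> \<psi> w] bd) auto
    also have "exp (k * (T - (t + y))) = exp (k * (T - t)) * exp (- k * y)"
      by (simp add: exp_add[symmetric] algebra_simps)
    finally show ?thesis by (simp add: mult_ac)
  qed
  have "integrable lborel (\<lambda>y. indicator {0<..T} y * (1 + 1 / sqrt y) * exp (\<bar>k\<bar> * T))"
    using integrable_inverse_sqrt by (rule integrable_mult_left)
  then have int: "integrable lborel (\<lambda>y. indicator {0<..T} y * ((1 + 1 / sqrt y) * exp (- k * y)))"
  proof (rule Bochner_Integration.integrable_bound)
    have "- k * y \<le> \<bar>k\<bar> * T" if "0 < y" "y \<le> T" for y
    proof -
      have "- k * y \<le> \<bar>k\<bar> * y" using that by (intro mult_right_mono) auto
      also have "\<dots> \<le> \<bar>k\<bar> * T" using that by (intro mult_left_mono) auto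
      finally show ?thesis .
    qed
    then show "AE y in lborel. norm (indicator {0<..T} y * ((1 + 1 / sqrt y) * exp (- k * y)))
        \<le> norm (indicator {0<..T} y * (1 + 1 / sqrt y) * exp (\<bar>k\<bar> * T))"
      by (intro AE_I2) (auto simp: indicator_def abs_mult intro!: mult_left_mono)
  qed simp
  have "\<bar>potential \<beta> w \<psi> s t\<bar>
      \<le> (\<integral>y. \<bar>indicator {0<..T - t} y * (\<beta> t (t + y) * average w \<psi> s t y)\<bar> \<partial>lborel)"
    unfolding potential_def
    using integral_norm_bound[of lborel "\<lambda>y. indicator {0<..T - t} y * (\<beta> t (t + y) * average w \<psi> s t y)"]
    by simp
  also have "\<dots> \<le> (\<integral>y. ?C * (indicator {0<..T} y * ((1 + 1 / sqrt y) * exp (- k * y))) \<partial>lborel)"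
    using le int integrand_integrable[OF \<beta> \<psi> w t, of s]
    by (intro integral_mono integrable_abs integrable_mult_right)
  finally show ?thesis by simp
qed

text \<open>The only discontinuity of the integrand in the parameters is at the end point \<open>y = T - t\<close> of the
  domain of integration, a null set; elsewhere the integrand is continuous or eventually zero.\<close>

lemma potential_continuous:
  assumes \<beta>: "admissible B \<beta>" and \<psi>: "bounded_cont K \<psi>" and w: "integrable std_gauss w"
  shows "continuous_on (UNIV \<times> {0..T}) (\<lambda>(s, t). potential \<beta> w \<psi> s t)"
proof (subst continuous_on_sequentially, safe)
  fix X :: "nat \<Rightarrow> real \<times> real" and s t
  assume mem: "\<forall>n. X n \<in> UNIV \<times> {0..T}" and "X \<longlonglongrightarrow> (s, t)" and t: "t \<in> {0..T}"
  define sn tn where "sn n = fst (X n)" and "tn n = snd (X n)" for n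
  have lims: "sn \<longlonglongrightarrow> s" "tn \<longlonglongrightarrow> t"
    unfolding sn_def tn_def using \<open>X \<longlonglongrightarrow> (s, t)\<close>
    by (auto intro!: tendsto_eq_intros)
  have tn: "0 \<le> tn n" "tn n \<le> T" for n using mem unfolding tn_def by (auto simp: mem_Times_iff)
  have K: "\<bar>\<psi> x u\<bar> \<le> K" "0 \<le> K" for x u
    using \<psi> order_trans[OF abs_ge_zero, of "\<psi> 0 0" K] by (auto simp: bounded_cont_def)
  have "(\<lambda>n. potential \<beta> w \<psi> (sn n) (tn n)) \<longlonglongrightarrow> potential \<beta> w \<psi> s t"
    unfolding potential_def
  proof (rule integral_dominated_convergence)
    show "integrable lborel (\<lambda>y. indicator {0<..T} y * (1 + 1 / sqrt y) * (B * (K * (\<integral>z. \<bar>w z\<bar> \<partial>std_gauss))))"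
      using integrable_inverse_sqrt by (rule integrable_mult_left)
    show "AE y in lborel. norm (indicator {0<..T - tn n} y * (\<beta> (tn n) (tn n + y) * average w \<psi> (sn n) (tn n) y))
        \<le> indicator {0<..T} y * (1 + 1 / sqrt y) * (B * (K * (\<integral>z. \<bar>w z\<bar> \<partial>std_gauss)))" for n
      using abs_integrand_le[OF \<beta> \<psi> w K(1) K(2) tn(1)] by (auto intro!: AE_I2)
    \<comment> \<open>the indicator does not converge at the end point of the domain\<close>
    have ne: "AE y in lborel. y \<noteq> T - t"
      by (rule AE_lborel_singleton)
    show "AE y in lborel. (\<lambda>n. indicator {0<..T - tn n} y * (\<beta> (tn n) (tn n + y) * average w \<psi> (sn n) (tn n) y))
      \<longlonglongrightarrow> indicator {0<..T - t} y * (\<beta> t (t + y) * average w \<psi> s t y)"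
      using ne
    proof eventually_elim
      case (elim y)
      consider "y \<le> 0" | "0 < y" "y < T - t" | "0 < y" "T - t < y" using elim by linarith
      then show ?case
      proof cases
        case 1
        then show ?thesis by simp
      next
        case 2
        have "\<forall>\<^sub>F n in sequentially. tn n < T - y"
          using order_tendstoD(2)[OF lims(2), of "T - y"] 2 by simp
        then have ev: "\<forall>\<^sub>F n in sequentially. indicator {0<..T - t} y = (indicator {0<..T - tn n} y :: real)"
          by eventually_elim (use 2 in auto)
        have "isCont (\<lambda>(t, u). \<beta> t u) (t, t + y)"
          using \<beta> 2 t unfolding admissible_def by auto
        moreover have "(\<lambda>n. (tn n, tn n + y)) \<longlonglongrightarrow> (t, t + y)"
          by (intro tendsto_intros lims)
        ultimately have l1: "(\<lambda>n. \<beta> (tn n) (tn n + y)) \<longlonglongrightarrow> \<beta> t (t + y)"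
          using isCont_tendsto_compose by fastforce
        have "(\<lambda>n. (sn n, tn n, y)) \<longlonglongrightarrow> (s, t, y)"
          by (intro tendsto_intros lims)
        from continuous_on_tendsto_compose[OF average_continuous[OF \<psi> w] this]
        have l2: "(\<lambda>n. average w \<psi> (sn n) (tn n) y) \<longlonglongrightarrow> average w \<psi> s t y" by simp
        show ?thesis
          by (intro tendsto_mult l1 l2 Lim_transform_eventually[OF tendsto_const ev])
      next
        case 3
        have "\<forall>\<^sub>F n in sequentially. T - y < tn n"
          using order_tendstoD(1)[OF lims(2), of "T - y"] 3 by simp
        then have ev: "\<forall>\<^sub>F n in sequentially. 0 =
            indicator {0<..T - tn n} y * (\<beta> (tn n) (tn n + y) * average w \<psi> (sn n) (tn n) y)"
          by eventually_elim auto
        show ?thesis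
          using Lim_transform_eventually[OF tendsto_const ev] 3 by simp
      qed
    qed
  qed (use integrand_measurable[OF \<beta> \<psi> w] in simp_all)
  then show "((\<lambda>(s, t). potential \<beta> w \<psi> s t) \<circ> X) \<longlonglongrightarrow> potential \<beta> w \<psi> s t"
    by (simp add: o_def case_prod_beta sn_def tn_def)
qed

lemma potential_has_derivative:
  assumes \<beta>: "admissible B (\<lambda>t u. b t u / c t u)" and one: "admissible B' (\<lambda>_ _. 1)"
    and c: "\<And>t u. 0 \<le> t \<Longrightarrow> t < u \<Longrightarrow> u \<le> T \<Longrightarrow> c t u \<noteq> 0"
    and \<psi>: "bounded_cont K \<psi>" and t: "t \<in> {0..T}"
  shows "((\<lambda>s. potential (\<lambda>_ _. 1) (\<lambda>_. 1) \<psi> s t) has_real_derivative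
     potential (\<lambda>t u. b t u / c t u) (\<lambda>z. z) \<psi> s t) (at s)"
  unfolding potential_def
proof (rule has_real_derivative_integral_dominated[where e = 1])
  interpret prob_space std_gauss by (rule prob_space_std_gauss)
  have w1: "integrable std_gauss (\<lambda>_. 1 :: real)" by simp
  have K: "\<bar>\<psi> x u\<bar> \<le> K" "0 \<le> K" for x u
    using \<psi> order_trans[OF abs_ge_zero, of "\<psi> 0 0" K] by (auto simp: bounded_cont_def)
  show "integrable lborel (\<lambda>y. indicator {0<..T - t} y * (1 * average (\<lambda>_. 1) \<psi> x t y))" for x
    using integrand_integrable[OF one \<psi> w1] t by auto
  show "integrable lborel (\<lambda>y. indicator {0<..T} y * (1 + 1 / sqrt y) * (B * (K * (\<integral>z. \<bar>z\<bar> \<partial>std_gauss))))"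
    using integrable_inverse_sqrt by (rule integrable_mult_left)
  show "\<bar>indicator {0<..T - t} y * (b t (t + y) / c t (t + y) * average (\<lambda>z. z) \<psi> x t y)\<bar>
      \<le> indicator {0<..T} y * (1 + 1 / sqrt y) * (B * (K * (\<integral>z. \<bar>z\<bar> \<partial>std_gauss)))" for x y
    using abs_integrand_le[OF \<beta> \<psi> integrable_id_std_gauss K(1) K(2)] t by auto
  show "(\<lambda>y. indicator {0<..T - t} y * (b t (t + y) / c t (t + y) * average (\<lambda>z. z) \<psi> s t y))
      \<in> borel_measurable lborel"
    using integrand_measurable[OF \<beta> \<psi> integrable_id_std_gauss] by simp
  show "((\<lambda>x. indicator {0<..T - t} y * (1 * average (\<lambda>_. 1) \<psi> x t y)) has_real_derivative
      indicator {0<..T - t} y * (b t (t + y) / c t (t + y) * average (\<lambda>z. z) \<psi> x t y)) (at x)" for x y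
  proof (cases "0 < y \<and> y \<le> T - t")
    case True
    let ?b = "b t (t + y)" and ?c = "c t (t + y)"
    have "?c \<noteq> 0" using c[of t "t + y"] True t by auto
    moreover have "(\<lambda>x. \<psi> x (t + y)) \<in> borel_measurable borel"
      using \<psi> by (intro section_measurable) (simp add: bounded_cont_def)
    ultimately have D: "((\<lambda>m. \<integral>z. \<psi> (m + ?c * z) (t + y) \<partial>std_gauss) has_real_derivative
       (\<integral>z. \<psi> (?b * x + ?c * z) (t + y) * z \<partial>std_gauss) / ?c) (at (?b * x))"
      using K(1) by (intro has_real_derivative_gauss_average) auto
    have "((\<lambda>x. ?b * x) has_real_derivative ?b) (at x)"
      by (auto intro!: derivative_eq_intros)
    from DERIV_chain2[OF D this] show ?thesis
      using True by (simp add: average_def mult.commute)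
  qed auto
qed simp

end

section \<open>The coefficients of the market\<close>

lemma exp_neg_lipschitz:
  fixes p q :: real
  assumes "0 \<le> p" "0 \<le> q"
  shows "\<bar>exp (- p) - exp (- q)\<bar> \<le> \<bar>p - q\<bar>"
proof -
  have "norm (exp (- p) - exp (- q)) \<le> 1 * norm (p - q)"
    by (rule field_differentiable_bound[where S = "{0..}" and f = "\<lambda>x. exp (- x)" and f' = "\<lambda>x. - exp (- x)"])
       (use assms in \<open>auto intro!: derivative_eq_intros\<close>)
  then show ?thesis by simp
qed

locale merton_market = market +
  assumes \<gamma>: "0 < \<gamma>" "\<gamma> < 1" and \<kappa>: "0 < \<kappa>" and \<sigma>: "0 < \<sigma>"
    and r: "r \<le> \<kappa>" "0 < \<kappa> + r" and T: "0 < T"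
begin

lemma \<gamma>\<^sub>1_pos: "0 < \<gamma>\<^sub>1"
  using \<gamma> \<sigma> by (simp add: \<gamma>\<^sub>1_def)

text \<open>This is where \<open>r \<le> \<kappa>\<close> enters: it gives \<open>\<kappa>\<^sub>1 \<le> 2 \<kappa>\<close>, hence
  \<open>\<sigma>\<^sup>2 c\<gamma>\<^sub>2 \<ge> \<kappa>\<^sub>1 (1 + \<gamma>) / 2\<close>, and \<open>((1 + \<gamma>) / 2)\<^sup>2\<close> exceeds \<open>\<gamma>\<close> by \<open>((1 - \<gamma>) / 2)\<^sup>2\<close>.\<close>

lemma discriminant_pos: "0 < c\<gamma>\<^sub>2\<^sup>2 - c\<gamma>\<^sub>3"
proof -
  define m where "m = \<gamma> * \<kappa>\<^sub>1 + \<kappa> * (1 - \<gamma>)"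
  have c2: "c\<gamma>\<^sub>2 = m / \<sigma>\<^sup>2"
    using \<gamma> \<sigma> by (simp add: c\<gamma>\<^sub>2_def \<gamma>\<^sub>2_def \<gamma>\<^sub>1_def m_def field_simps)
  have c3: "c\<gamma>\<^sub>3 = \<gamma> * \<kappa>\<^sub>1\<^sup>2 / (\<sigma>\<^sup>2)\<^sup>2"
    using \<gamma> \<sigma> by (simp add: c\<gamma>\<^sub>3_def \<gamma>\<^sub>3_def \<gamma>\<^sub>1_def power2_eq_square)
  have k1: "0 < \<kappa>\<^sub>1" "\<kappa>\<^sub>1 / 2 \<le> \<kappa>" using r by (auto simp: \<kappa>\<^sub>1_def)
  have "\<kappa>\<^sub>1 * (1 + \<gamma>) / 2 = \<gamma> * \<kappa>\<^sub>1 + \<kappa>\<^sub>1 / 2 * (1 - \<gamma>)" by (simp add: field_simps)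
  also have "\<dots> \<le> m"
    unfolding m_def using k1 \<gamma> by (intro add_left_mono mult_right_mono) auto
  finally have "(\<kappa>\<^sub>1 * (1 + \<gamma>) / 2)\<^sup>2 \<le> m\<^sup>2" using k1 \<gamma> by (intro power_mono) auto
  moreover have "(\<kappa>\<^sub>1 * (1 + \<gamma>) / 2)\<^sup>2 = \<gamma> * \<kappa>\<^sub>1\<^sup>2 + (\<kappa>\<^sub>1 * (1 - \<gamma>) / 2)\<^sup>2"
    by (simp add: power2_eq_square field_simps)
  moreover have "0 < (\<kappa>\<^sub>1 * (1 - \<gamma>) / 2)\<^sup>2" using k1 \<gamma> by simp
  ultimately have "\<gamma> * \<kappa>\<^sub>1\<^sup>2 < m\<^sup>2" by linarith
  then show ?thesis using \<sigma> by (simp add: c2 c3 power_divide divide_strict_right_mono)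
qed

lemma \<theta>_pos: "0 < \<theta>"
  using discriminant_pos by (simp add: \<theta>_def)

lemma \<theta>_le: "\<theta> \<le> c\<gamma>\<^sub>2"
proof -
  have "0 \<le> c\<gamma>\<^sub>2"
    using \<gamma> \<sigma> \<kappa> r by (auto simp: c\<gamma>\<^sub>2_def \<gamma>\<^sub>2_def \<gamma>\<^sub>1_def \<kappa>\<^sub>1_def intro!: divide_nonneg_pos add_nonneg_nonneg)
  moreover have "0 \<le> c\<gamma>\<^sub>3"
    using \<gamma> \<sigma> by (auto simp: c\<gamma>\<^sub>3_def \<gamma>\<^sub>3_def \<gamma>\<^sub>1_def)
  ultimately show ?thesis unfolding \<theta>_def by (intro real_le_lsqrt) auto
qed

text \<open>Beyond \<open>T\<close> the denominator in \<open>g\<close> may vanish; up to \<open>T\<close> it does not, so \<open>g\<close> is continuous and the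
  Riccati solution does not explode.\<close>

lemma g_denominator_ge:
  assumes "t \<le> T"
  shows "2 * \<theta> \<le> exp (\<omega> * (T - t)) * (c\<gamma>\<^sub>2 + \<theta>) - c\<gamma>\<^sub>2 + \<theta>"
proof -
  have "0 \<le> \<omega> * (T - t)" using assms \<theta>_pos \<gamma>\<^sub>1_pos by (simp add: \<omega>_def)
  then have "1 * (c\<gamma>\<^sub>2 + \<theta>) \<le> exp (\<omega> * (T - t)) * (c\<gamma>\<^sub>2 + \<theta>)"
    using \<theta>_pos \<theta>_le by (intro mult_right_mono) auto
  moreover have "2 * \<theta> \<le> x - c\<gamma>\<^sub>2 + \<theta>" if "1 * (c\<gamma>\<^sub>2 + \<theta>) \<le> x" for x
    using that by (simp add: algebra_simps)
  ultimately show ?thesis by blast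
qed

lemma g_continuous: "continuous_on {0..T} g"
proof -
  have "exp (\<omega> * (T - t)) * (c\<gamma>\<^sub>2 + \<theta>) - c\<gamma>\<^sub>2 + \<theta> \<noteq> 0" if "t \<in> {0..T}" for t
    using g_denominator_ge[of t] \<theta>_pos that by auto
  then show ?thesis unfolding g_def by (intro continuous_intros) auto
qed

text \<open>Nonnegativity keeps \<open>G\<close> in \<open>[0, 1]\<close> for \<open>y \<ge> 0\<close> and makes it Lipschitz in \<open>y\<close> there,
  uniformly in \<open>s\<close>.\<close>

lemma g_nonneg:
  assumes "t \<le> T"
  shows "0 \<le> g t"
proof -
  let ?D = "exp (\<omega> * (T - t)) * (c\<gamma>\<^sub>2 + \<theta>) - c\<gamma>\<^sub>2 + \<theta>"
  have D: "2 * \<theta> \<le> ?D" by (rule g_denominator_ge[OF assms])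
  have "2 * \<theta> * (c\<gamma>\<^sub>2 - \<theta>) / ?D \<le> ?D * (c\<gamma>\<^sub>2 - \<theta>) / ?D"
    using D \<theta>_pos \<theta>_le by (intro divide_right_mono mult_right_mono) auto
  also have "\<dots> = c\<gamma>\<^sub>2 - \<theta>" using D \<theta>_pos by simp
  finally show ?thesis by (simp add: g_def)
qed

lemma g\<^sub>1_continuous: "continuous_on {0..T} g\<^sub>1"
  unfolding g\<^sub>1_def by (intro continuous_intros g_continuous)

text \<open>Times are projected onto the horizon, which turns functions that are continuous on it into
  globally continuous ones.\<close>

definition clamp_time :: "real \<Rightarrow> real" where
  "clamp_time u = max 0 (min T u)"

lemma clamp_time_mem: "clamp_time u \<in> {0..T}"
  using T by (auto simp: clamp_time_def)

lemma clamp_time_id: "u \<in> {0..T} \<Longrightarrow> clamp_time u = u"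
  by (auto simp: clamp_time_def)

lemma clamp_time_continuous: "continuous_on S clamp_time"
  unfolding clamp_time_def by (intro continuous_intros)

lemma continuous_on_clamp:
  assumes "continuous_on {0..T} f"
  shows "continuous_on UNIV (\<lambda>u. f (clamp_time u))"
  using continuous_on_compose2[OF assms clamp_time_continuous] clamp_time_mem by blast

text \<open>The integrating factor of the equation for \<open>\<eta>\<close>, and the clock of its martingale part (up to
  the factor \<open>\<sigma>\<^sup>2\<close>).\<close>

definition discount :: "real \<Rightarrow> real" where
  "discount t = exp (- integral {0..clamp_time t} g\<^sub>1)"

definition clock :: "real \<Rightarrow> real" where
  "clock t = integral {0..clamp_time t} (\<lambda>v. (discount v)\<^sup>2)"

definition flow_mean :: "real \<Rightarrow> real \<Rightarrow> real" where
  "flow_mean t u = discount t / discount u"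

definition flow_sd :: "real \<Rightarrow> real \<Rightarrow> real" where
  "flow_sd t u = \<sigma> * sqrt (clock u - clock t) / discount u"

lemma discount_pos: "0 < discount t"
  by (simp add: discount_def)

lemma discount_continuous: "continuous_on UNIV discount"
proof -
  have "continuous_on {0..T} (\<lambda>t. integral {0..t} g\<^sub>1)"
    by (intro indefinite_integral_continuous_1 integrable_continuous_real g\<^sub>1_continuous)
  from continuous_on_clamp[OF this] show ?thesis
    unfolding discount_def by (intro continuous_intros)
qed

lemma discount_sq_continuous: "continuous_on S (\<lambda>v. (discount v)\<^sup>2)"
  by (intro continuous_intros continuous_on_subset[OF discount_continuous]) auto

lemma clock_continuous: "continuous_on UNIV clock"
proof -
  have "continuous_on {0..T} (\<lambda>t. integral {0..t} (\<lambda>v. (discount v)\<^sup>2))"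
    by (intro indefinite_integral_continuous_1 integrable_continuous_real discount_sq_continuous)
  from continuous_on_clamp[OF this] show ?thesis unfolding clock_def .
qed

lemma discount_has_derivative:
  assumes "v \<in> {0..T}"
  shows "(discount has_real_derivative - g\<^sub>1 v * discount v) (at v within {0..T})"
proof -
  have "((\<lambda>t. exp (- integral {0..t} g\<^sub>1)) has_real_derivative
      exp (- integral {0..v} g\<^sub>1) * - g\<^sub>1 v) (at v within {0..T})"
    using assms g\<^sub>1_continuous
    by (intro DERIV_chain2[OF DERIV_exp] DERIV_minus integral_has_real_derivative)
  then have "((\<lambda>t. exp (- integral {0..t} g\<^sub>1)) has_real_derivative - g\<^sub>1 v * discount v) (at v within {0..T})"
    using assms by (simp add: discount_def clamp_time_id mult.commute)
  then show ?thesis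
    by (rule has_field_derivative_transform_within[OF _ zero_less_one])
       (use assms in \<open>auto simp: discount_def clamp_time_id\<close>)
qed

lemma clock_has_derivative:
  assumes "v \<in> {0..T}"
  shows "(clock has_real_derivative (discount v)\<^sup>2) (at v within {0..T})"
proof -
  have "((\<lambda>t. integral {0..t} (\<lambda>v. (discount v)\<^sup>2)) has_real_derivative (discount v)\<^sup>2) (at v within {0..T})"
    using assms discount_sq_continuous by (intro integral_has_real_derivative)
  then show ?thesis
    by (rule has_field_derivative_transform_within[OF _ zero_less_one])
       (use assms in \<open>auto simp: clock_def clamp_time_id\<close>)
qed

lemma discount_bounds:
  obtains lo hi where "0 < lo" "\<And>v. v \<in> {0..T} \<Longrightarrow> lo \<le> discount v" "\<And>v. v \<in> {0..T} \<Longrightarrow> discount v \<le> hi"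
proof -
  have ne: "{0..T} \<noteq> {}" using T by simp
  have c: "continuous_on {0..T} discount" by (rule continuous_on_subset[OF discount_continuous]) auto
  obtain p where "\<forall>v\<in>{0..T}. discount p \<le> discount v"
    using continuous_attains_inf[OF compact_Icc ne c] by blast
  moreover obtain q where "\<forall>v\<in>{0..T}. discount v \<le> discount q"
    using continuous_attains_sup[OF compact_Icc ne c] by blast
  ultimately show ?thesis using that[of "discount p" "discount q"] discount_pos by blast
qed

lemma clock_increment_ge:
  assumes "0 \<le> t" "t \<le> u" "u \<le> T" and lo: "0 < lo" "\<And>v. v \<in> {0..T} \<Longrightarrow> lo \<le> discount v"
  shows "lo\<^sup>2 * (u - t) \<le> clock u - clock t"
proof -
  have i: "(\<lambda>v. (discount v)\<^sup>2) integrable_on {p..q}" for p q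
    by (intro integrable_continuous_real discount_sq_continuous)
  have "integral {0..t} (\<lambda>v. (discount v)\<^sup>2) + integral {t..u} (\<lambda>v. (discount v)\<^sup>2)
      = integral {0..u} (\<lambda>v. (discount v)\<^sup>2)"
    using assms i by (intro Henstock_Kurzweil_Integration.integral_combine) auto
  then have "clock u - clock t = integral {t..u} (\<lambda>v. (discount v)\<^sup>2)"
    using assms by (simp add: clock_def clamp_time_id)
  moreover have "integral {t..u} (\<lambda>_. lo\<^sup>2) \<le> integral {t..u} (\<lambda>v. (discount v)\<^sup>2)"
    using assms by (intro integral_le i power_mono lo) auto
  ultimately show ?thesis using assms by (simp add: mult.commute)
qed

sublocale flow: gaussian_flow flow_mean flow_sd T
proof
  have d: "continuous_on UNIV (\<lambda>p :: real \<times> real. discount (fst p))"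
          "continuous_on UNIV (\<lambda>p :: real \<times> real. discount (snd p))"
    by (intro continuous_on_compose2[OF discount_continuous] continuous_intros; simp)+
  have k: "continuous_on UNIV (\<lambda>p :: real \<times> real. clock (fst p))"
          "continuous_on UNIV (\<lambda>p :: real \<times> real. clock (snd p))"
    by (intro continuous_on_compose2[OF clock_continuous] continuous_intros; simp)+
  have ne: "discount v \<noteq> 0" for v using discount_pos[of v] by simp
  show "continuous_on UNIV (\<lambda>(t, u). flow_mean t u)"
    unfolding flow_mean_def case_prod_beta using ne by (intro continuous_intros d) auto
  show "continuous_on UNIV (\<lambda>(t, u). flow_sd t u)"
    unfolding flow_sd_def case_prod_beta using ne by (intro continuous_intros d k) auto
qed

lemma flow_sd_pos:
  assumes "0 \<le> t" "t < u" "u \<le> T"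
  shows "0 < flow_sd t u"
proof -
  obtain lo hi where lo: "0 < lo" "\<And>v. v \<in> {0..T} \<Longrightarrow> lo \<le> discount v"
    using discount_bounds by metis
  have "0 < lo\<^sup>2 * (u - t)" using assms lo by simp
  also have "\<dots> \<le> clock u - clock t" using assms lo by (intro clock_increment_ge) auto
  finally show ?thesis using \<sigma> discount_pos[of u] by (simp add: flow_sd_def)
qed

lemma admissible_one: "flow.admissible 1 (\<lambda>_ _. 1)"
proof -
  have "(\<lambda>(t :: real, u :: real). 1 :: real) = (\<lambda>_. 1)" by auto
  then show ?thesis by (auto simp: flow.admissible_def)
qed

text \<open>The clock runs at a speed bounded below, so \<open>flow_sd t u\<close> is at least of order \<open>sqrt (u - t)\<close>.\<close>

lemma admissible_ratio:
  obtains B where "flow.admissible B (\<lambda>t u. flow_mean t u / flow_sd t u)"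
proof -
  obtain lo hi where lo: "0 < lo" "\<And>v. v \<in> {0..T} \<Longrightarrow> lo \<le> discount v"
    and hi: "\<And>v. v \<in> {0..T} \<Longrightarrow> discount v \<le> hi"
    by (rule discount_bounds) blast
  have hi0: "0 < hi" using lo(1) lo(2)[of 0] hi[of 0] T by auto
  define B where "B = hi / (\<sigma> * lo)"
  have B: "0 \<le> B" using hi0 lo \<sigma> by (simp add: B_def)
  have cont: "isCont (\<lambda>(t, u). flow_mean t u / flow_sd t u) (t, u)"
    if "0 \<le> t" "t < u" "u \<le> T" for t u
  proof -
    have "isCont (\<lambda>(t, u). flow_mean t u) (t, u)" "isCont (\<lambda>(t, u). flow_sd t u) (t, u)"
      using flow.b_cont flow.c_cont by (auto simp: continuous_on_eq_continuous_at)
    then show ?thesis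
      using flow_sd_pos[OF that] unfolding case_prod_beta by (intro isCont_divide) auto
  qed
  have bound: "\<bar>flow_mean t u / flow_sd t u\<bar> \<le> B * (1 + 1 / sqrt (u - t))"
    if tu: "0 \<le> t" "t < u" "u \<le> T" for t u
  proof -
    have "lo * sqrt (u - t) = sqrt (lo\<^sup>2 * (u - t))" using lo by (simp add: real_sqrt_mult)
    also have "\<dots> \<le> sqrt (clock u - clock t)"
      using tu lo by (intro real_sqrt_le_mono clock_increment_ge) auto
    finally have sq: "lo * sqrt (u - t) \<le> sqrt (clock u - clock t)" .
    have p: "0 < lo * sqrt (u - t)" using lo tu by simp
    have "\<bar>flow_mean t u / flow_sd t u\<bar> = discount t / (\<sigma> * sqrt (clock u - clock t))"
      using discount_pos[of t] discount_pos[of u] \<sigma> p sq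
      by (simp add: flow_mean_def flow_sd_def abs_mult)
    also have "\<dots> \<le> hi / (\<sigma> * (lo * sqrt (u - t)))"
      using sq p lo(1) \<sigma> hi[of t] hi0 tu by (intro frac_le mult_left_mono mult_pos_pos) auto
    also have "\<dots> = B * (1 / sqrt (u - t))" by (simp add: B_def)
    also have "\<dots> \<le> B * (1 + 1 / sqrt (u - t))" using B by (intro mult_left_mono) auto
    finally show ?thesis .
  qed
  have meas: "(\<lambda>u. flow_mean t u / flow_sd t u) \<in> borel_measurable borel" for t
  proof -
    have [measurable]: "discount \<in> borel_measurable borel" "clock \<in> borel_measurable borel"
      by (auto intro: borel_measurable_continuous_onI discount_continuous clock_continuous)
    show ?thesis unfolding flow_mean_def flow_sd_def by measurable
  qed
  show ?thesis
    using B cont bound meas by (intro that[of B]) (auto simp: flow.admissible_def)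
qed

section \<open>The running reward\<close>

definition reward :: "(real \<Rightarrow> real \<Rightarrow> real) \<Rightarrow> real \<Rightarrow> real \<Rightarrow> real" where
  "reward h x u = \<Psi> h x (clamp_time u)"

definition lip :: real where
  "lip = \<sigma>\<^sup>2 * \<bar>B\<^sub>1\<bar> / (1 - \<gamma>) + varpi powr (- 1 / (1 - \<gamma>))"

lemma lip_nonneg: "0 \<le> lip"
  using \<gamma> by (simp add: lip_def)

lemma \<Psi>_lipschitz:
  assumes h: "h \<in> X" and f: "f \<in> X" and t: "t \<in> {0..T}"
  shows "\<bar>\<Psi> h x t - \<Psi> f x t\<bar> \<le> lip * (\<bar>h x t - f x t\<bar> + \<bar>d_s h x t - d_s f x t\<bar>)"
proof -
  let ?w = "varpi powr (- 1 / (1 - \<gamma>))"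
  have hs: "\<bar>d_s h x t\<bar> \<le> B\<^sub>1" "0 \<le> h x t" and fs: "\<bar>d_s f x t\<bar> \<le> B\<^sub>1" "0 \<le> f x t"
    using h f t by (auto simp: X_def)
  let ?A = "\<sigma>\<^sup>2 * ((d_s h x t)\<^sup>2 - (d_s f x t)\<^sup>2) / (2 * (1 - \<gamma>))"
  let ?E = "(1 - \<gamma>) * ?w * (G x t (h x t) - G x t (f x t))"
  have eq: "\<Psi> h x t - \<Psi> f x t = ?A + ?E"
    by (simp add: \<Psi>_def algebra_simps diff_divide_distrib)
  have "\<bar>(d_s h x t)\<^sup>2 - (d_s f x t)\<^sup>2\<bar> = \<bar>d_s h x t + d_s f x t\<bar> * \<bar>d_s h x t - d_s f x t\<bar>"
    by (simp add: abs_mult[symmetric] power2_eq_square algebra_simps)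
  also have "\<dots> \<le> (2 * \<bar>B\<^sub>1\<bar>) * \<bar>d_s h x t - d_s f x t\<bar>"
    using hs fs by (intro mult_right_mono) auto
  finally have sq: "\<bar>(d_s h x t)\<^sup>2 - (d_s f x t)\<^sup>2\<bar> \<le> 2 * \<bar>B\<^sub>1\<bar> * \<bar>d_s h x t - d_s f x t\<bar>" .
  have "\<bar>?A\<bar> = \<sigma>\<^sup>2 / (2 * (1 - \<gamma>)) * \<bar>(d_s h x t)\<^sup>2 - (d_s f x t)\<^sup>2\<bar>"
    using \<gamma> by (simp add: abs_mult)
  also have "\<dots> \<le> \<sigma>\<^sup>2 / (2 * (1 - \<gamma>)) * (2 * \<bar>B\<^sub>1\<bar> * \<bar>d_s h x t - d_s f x t\<bar>)"
    using \<gamma> by (intro mult_left_mono sq) auto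
  also have "\<dots> = \<sigma>\<^sup>2 * \<bar>B\<^sub>1\<bar> / (1 - \<gamma>) * \<bar>d_s h x t - d_s f x t\<bar>"
    using \<gamma> by (simp add: field_simps)
  finally have A: "\<bar>?A\<bar> \<le> \<sigma>\<^sup>2 * \<bar>B\<^sub>1\<bar> / (1 - \<gamma>) * \<bar>d_s h x t - d_s f x t\<bar>" .
  have g0: "0 \<le> g t" using g_nonneg t by simp
  have "\<bar>G x t (h x t) - G x t (f x t)\<bar>
      \<le> \<bar>1 / (1 - \<gamma>) * (x\<^sup>2 / 2 * g t + h x t) - 1 / (1 - \<gamma>) * (x\<^sup>2 / 2 * g t + f x t)\<bar>"
    unfolding G_def minus_mult_left[symmetric]
    using g0 hs fs \<gamma> by (intro exp_neg_lipschitz mult_nonneg_nonneg add_nonneg_nonneg) auto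
  also have "\<dots> = 1 / (1 - \<gamma>) * \<bar>h x t - f x t\<bar>"
    using \<gamma> by (simp add: right_diff_distrib[symmetric] abs_mult del: times_divide_eq_left mult_1)
  finally have "\<bar>?E\<bar> \<le> ((1 - \<gamma>) * ?w) * (1 / (1 - \<gamma>) * \<bar>h x t - f x t\<bar>)"
    unfolding abs_mult using \<gamma> by (intro mult_mono) auto
  also have "\<dots> = ?w * \<bar>h x t - f x t\<bar>" using \<gamma> by simp
  finally have E: "\<bar>?E\<bar> \<le> ?w * \<bar>h x t - f x t\<bar>" .
  have "0 \<le> \<sigma>\<^sup>2 * \<bar>B\<^sub>1\<bar> / (1 - \<gamma>) * \<bar>h x t - f x t\<bar>" "0 \<le> ?w * \<bar>d_s h x t - d_s f x t\<bar>"
    using \<gamma> by auto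
  then show ?thesis
    unfolding eq lip_def distrib_left distrib_right using A E abs_triangle_ineq[of ?A ?E] by linarith
qed

lemma reward_bounded_cont:
  assumes h: "h \<in> X"
  obtains K where "flow.bounded_cont K (reward h)"
proof -
  let ?w = "varpi powr (- 1 / (1 - \<gamma>))"
  have hc: "continuous_on (UNIV \<times> {0..T}) (\<lambda>p. h (fst p) (snd p))"
    and hsc: "continuous_on (UNIV \<times> {0..T}) (\<lambda>p. d_s h (fst p) (snd p))"
    using h by (auto simp: X_def C10_def case_prod_beta)
  have gc: "continuous_on (UNIV \<times> {0..T}) (\<lambda>p :: real \<times> real. g (snd p))"
    by (rule continuous_on_compose2[OF g_continuous]) (auto intro!: continuous_intros)
  have "continuous_on (UNIV \<times> {0..T}) (\<lambda>p. \<Psi> h (fst p) (snd p))"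
    unfolding \<Psi>_def G_def using \<gamma> by (intro continuous_intros hc hsc gc) auto
  then have "continuous_on UNIV (\<lambda>p. \<Psi> h (fst (fst p, clamp_time (snd p))) (snd (fst p, clamp_time (snd p))))"
    by (rule continuous_on_compose2)
       (auto intro!: continuous_intros continuous_on_compose2[OF clamp_time_continuous[of UNIV]] clamp_time_mem
         simp del: atLeastAtMost_iff)
  then have cont: "continuous_on UNIV (\<lambda>(x, u). reward h x u)"
    by (simp add: reward_def case_prod_beta)
  obtain q where q: "\<And>t. t \<in> {0..T} \<Longrightarrow> g t \<le> q"
    using continuous_attains_sup[OF compact_Icc _ g_continuous] T by fastforce
  define K where "K = \<sigma>\<^sup>2 * B\<^sub>1\<^sup>2 / (2 * (1 - \<gamma>)) + \<sigma>\<^sup>2 * q / 2 + \<bar>r * \<gamma>\<bar> + (1 - \<gamma>) * ?w"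
  have "\<bar>\<Psi> h x t\<bar> \<le> K" if t: "t \<in> {0..T}" for x t
  proof -
    have hs: "\<bar>d_s h x t\<bar> \<le> B\<^sub>1" "0 \<le> h x t" using h t by (auto simp: X_def)
    have "(d_s h x t)\<^sup>2 \<le> B\<^sub>1\<^sup>2" using hs(1) by (rule power2_le_iff_abs_le[THEN iffD2, rotated]) (use hs in linarith)
    then have "\<sigma>\<^sup>2 * (d_s h x t)\<^sup>2 / (2 * (1 - \<gamma>)) \<le> \<sigma>\<^sup>2 * B\<^sub>1\<^sup>2 / (2 * (1 - \<gamma>))"
      using \<gamma> by (intro divide_right_mono mult_left_mono) auto
    moreover have "0 \<le> \<sigma>\<^sup>2 * (d_s h x t)\<^sup>2 / (2 * (1 - \<gamma>))" using \<gamma> by simp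
    moreover have "0 \<le> \<sigma>\<^sup>2 * g t / 2" "\<sigma>\<^sup>2 * g t / 2 \<le> \<sigma>\<^sup>2 * q / 2"
      using g_nonneg[of t] q[of t] t by (auto intro!: mult_left_mono)
    moreover have "0 \<le> (1 - \<gamma>) * ?w * G x t (h x t)" using \<gamma> by (simp add: G_def)
    moreover have "(1 - \<gamma>) * ?w * G x t (h x t) \<le> (1 - \<gamma>) * ?w"
      using \<gamma> g_nonneg[of t] hs t by (intro mult_left_le) (auto simp: G_def)
    ultimately show ?thesis unfolding \<Psi>_def K_def by linarith
  qed
  then have "flow.bounded_cont K (reward h)"
    using cont clamp_time_mem by (simp add: flow.bounded_cont_def reward_def)
  then show ?thesis by (rule that)
qed

section \<open>The mapping as a potential\<close>

text \<open>At the initial time the diffusion is degenerate and its normal law unavailable, but a single time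
  does not affect the integral; for later times the law is that of the Gaussian flow.\<close>

lemma L_eq_potential:
  assumes bm: "standard_brownian_motion M W"
    and sde: "\<And>s t. 0 \<le> t \<Longrightarrow> t \<le> T \<Longrightarrow> solves_sde M W s t (\<eta> s t)"
    and t: "t \<in> {0..T}" and h: "h \<in> X"
  shows "L M \<eta> h s t = flow.potential (\<lambda>_ _. 1) (\<lambda>_. 1) (reward h) s t"
proof -
  interpret N: prob_space std_gauss by (rule prob_space_std_gauss)
  have w1: "integrable std_gauss (\<lambda>_. 1 :: real)" by simp
  obtain K where K: "flow.bounded_cont K (reward h)" by (rule reward_bounded_cont[OF h])
  let ?F = "\<lambda>u. flow.average (\<lambda>_. 1) (reward h) s t (u - t)"
  have law: "(\<integral>w. \<Psi> h (\<eta> s t u w) u \<partial>M) = ?F u" if u: "u \<in> {t<..T}" for u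
  proof -
    have sub: "{t..u} \<subseteq> {0..T}" using t u by auto
    have c: "continuous_on UNIV (\<lambda>x. (x, u))" by (intro continuous_intros)
    have cr: "continuous_on UNIV (\<lambda>x. reward h x u)"
      using K continuous_on_compose2[of UNIV "\<lambda>(x, u). reward h x u", OF _ c]
      by (simp add: flow.bounded_cont_def)
    have "(\<integral>w. reward h (\<eta> s t u w) u \<partial>M) =
        (\<integral>z. reward h (discount t / discount u * s + \<sigma> * sqrt (clock u - clock t) / discount u * z) u \<partial>std_gauss)"
    proof (rule linear_sde_expectation[OF bm _ _ \<sigma> discount_pos, where \<beta> = g\<^sub>1
          and \<psi> = "\<lambda>x. reward h x u" and x = "\<eta> s t"])
      show "(discount has_real_derivative - g\<^sub>1 v * discount v) (at v within {t..u})" if "v \<in> {t..u}" for v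
        using discount_has_derivative sub that by (blast intro: has_field_derivative_subset)
      show "(clock has_real_derivative (discount v)\<^sup>2) (at v within {t..u})" if "v \<in> {t..u}" for v
        using clock_has_derivative sub that by (blast intro: has_field_derivative_subset)
      show "continuous_on {t..u} g\<^sub>1" by (rule continuous_on_subset[OF g\<^sub>1_continuous sub])
      show "\<eta> s t u \<in> borel_measurable M" using sde[of t s] t u by (auto simp: solves_sde_def)
      have "AE w in M. continuous_on {t..T} (\<lambda>u. \<eta> s t u w) \<and>
        (\<forall>u\<in>{t..T}. \<eta> s t u w = s + integral {t..u} (\<lambda>v. g\<^sub>1 v * \<eta> s t v w) + \<sigma> * (W u w - W t w))"
        using sde[of t s] t by (simp add: solves_sde_def)
      then show "AE w in M. continuous_on {t..u} (\<lambda>v. \<eta> s t v w) \<and>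
        (\<forall>v\<in>{t..u}. \<eta> s t v w = s + integral {t..v} (\<lambda>v. g\<^sub>1 v * \<eta> s t v w) + \<sigma> * (W v w - W t w))"
        by eventually_elim (use u in \<open>auto intro: continuous_on_subset\<close>)
      show "\<bar>reward h y u\<bar> \<le> K" for y using K by (simp add: flow.bounded_cont_def)
    qed (use t u cr in auto)
    then show ?thesis
      using t u by (simp add: flow.average_def reward_def clamp_time_id flow_mean_def flow_sd_def)
  qed
  have "continuous_on {t..T} ?F"
  proof -
    have c: "continuous_on {t..T} (\<lambda>u. (s, t, u - t))" by (intro continuous_intros)
    from continuous_on_compose2[OF flow.average_continuous[OF K w1] c] show ?thesis by simp
  qed
  then have "set_integrable lborel {t..T} ?F" by (rule borel_integrable_atLeastAtMost')
  then have "set_integrable lborel {t<..T} ?F" by (rule set_integrable_subset) auto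
  note F = set_borel_integral_eq_integral(2)[OF this]
  have "L M \<eta> h s t = integral {t<..T} (\<lambda>u. \<integral>w. \<Psi> h (\<eta> s t u w) u \<partial>M)"
    unfolding L_def
    by (intro integral_spike_set) (auto intro!: negligible_subset[OF negligible_sing[of t]])
  also have "\<dots> = integral {t<..T} ?F" by (intro integral_cong law)
  also have "\<dots> = (\<integral>u. indicator {t<..T} u *\<^sub>R ?F u \<partial>lborel)"
    by (simp only: F[symmetric] set_lebesgue_integral_def)
  also have "\<dots> = (\<integral>y. indicator {t<..T} (t + y) *\<^sub>R ?F (t + y) \<partial>lborel)"
    by (subst lborel_integral_real_affine[where c = 1 and t = t]) simp_all
  also have "\<dots> = flow.potential (\<lambda>_ _. 1) (\<lambda>_. 1) (reward h) s t"
    unfolding flow.potential_def by (intro Bochner_Integration.integral_cong) (auto simp: indicator_def)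
  finally show ?thesis .
qed

lemma d_s_L_eq_potential:
  assumes bm: "standard_brownian_motion M W"
    and sde: "\<And>s t. 0 \<le> t \<Longrightarrow> t \<le> T \<Longrightarrow> solves_sde M W s t (\<eta> s t)"
    and t: "t \<in> {0..T}" and h: "h \<in> X"
  shows "((\<lambda>s. L M \<eta> h s t) has_real_derivative
     flow.potential (\<lambda>t u. flow_mean t u / flow_sd t u) (\<lambda>z. z) (reward h) s t) (at s)"
    and "d_s (L M \<eta> h) s t =
     flow.potential (\<lambda>t u. flow_mean t u / flow_sd t u) (\<lambda>z. z) (reward h) s t"
proof -
  obtain K where K: "flow.bounded_cont K (reward h)" by (rule reward_bounded_cont[OF h])
  obtain B where B: "flow.admissible B (\<lambda>t u. flow_mean t u / flow_sd t u)" by (rule admissible_ratio)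
  have eq: "(\<lambda>s. L M \<eta> h s t) = (\<lambda>s. flow.potential (\<lambda>_ _. 1) (\<lambda>_. 1) (reward h) s t)"
    using L_eq_potential[OF bm sde t h] t by auto
  show D: "((\<lambda>s. L M \<eta> h s t) has_real_derivative
     flow.potential (\<lambda>t u. flow_mean t u / flow_sd t u) (\<lambda>z. z) (reward h) s t) (at s)"
    unfolding eq
    by (rule flow.potential_has_derivative[OF B admissible_one _ K t]) (use flow_sd_pos in force)
  then show "d_s (L M \<eta> h) s t =
     flow.potential (\<lambda>t u. flow_mean t u / flow_sd t u) (\<lambda>z. z) (reward h) s t"
    unfolding d_s_def by (rule DERIV_imp_deriv)
qed

lemma L_mem_C10:
  assumes bm: "standard_brownian_motion M W"
    and sde: "\<And>s t. 0 \<le> t \<Longrightarrow> t \<le> T \<Longrightarrow> solves_sde M W s t (\<eta> s t)" and h: "h \<in> X"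
  shows "L M \<eta> h \<in> C10"
proof -
  interpret N: prob_space std_gauss by (rule prob_space_std_gauss)
  have w1: "integrable std_gauss (\<lambda>_. 1 :: real)" by simp
  obtain K where K: "flow.bounded_cont K (reward h)" by (rule reward_bounded_cont[OF h])
  obtain B where B: "flow.admissible B (\<lambda>t u. flow_mean t u / flow_sd t u)" by (rule admissible_ratio)
  note D = d_s_L_eq_potential[OF bm sde _ h]
  have "(\<lambda>x. L M \<eta> h x t) differentiable (at s)" if "t \<in> {0..T}" for s t
    using D(1)[OF _ _ that, of s] real_differentiable_def by blast
  moreover have "continuous_on (UNIV \<times> {0..T}) (\<lambda>(s, t). L M \<eta> h s t)"
    using flow.potential_continuous[OF admissible_one K w1]
    by (rule continuous_on_eq) (auto simp: L_eq_potential[OF bm sde _ h])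
  moreover have "continuous_on (UNIV \<times> {0..T}) (\<lambda>(s, t). d_s (L M \<eta> h) s t)"
    using flow.potential_continuous[OF B K integrable_id_std_gauss]
    by (rule continuous_on_eq) (auto simp: D(2))
  ultimately show ?thesis by (simp add: C10_def)
qed

text \<open>The Lipschitz constant of the reward and the kernel bounds do not depend on \<open>k\<close>, so \<open>k\<close> can be chosen
  from \<open>l\<close> alone, before \<open>h\<close> and \<open>f\<close>.\<close>

lemma L_contraction:
  assumes bm: "standard_brownian_motion M W"
    and sde: "\<And>s t. 0 \<le> t \<Longrightarrow> t \<le> T \<Longrightarrow> solves_sde M W s t (\<eta> s t)" and l: "0 < l"
  shows "\<exists>k\<ge>1. \<forall>h\<in>X. \<forall>f\<in>X. \<rho> k (L M \<eta> h) (L M \<eta> f) \<le> ennreal l * \<rho> k h f"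
proof -
  interpret N: prob_space std_gauss by (rule prob_space_std_gauss)
  have w1: "integrable std_gauss (\<lambda>_. 1 :: real)" by simp
  obtain B where B: "flow.admissible B (\<lambda>t u. flow_mean t u / flow_sd t u)" by (rule admissible_ratio)
  let ?ratio = "\<lambda>t u. flow_mean t u / flow_sd t u"
  define Z where "Z = (\<integral>z. \<bar>z\<bar> \<partial>std_gauss)"
  define J where "J k = (\<integral>y. indicator {0<..T} y * ((1 + 1 / sqrt y) * exp (- k * y)) \<partial>lborel)" for k
  \<comment> \<open>\<open>1\<close> bounds the kernel of the values, \<open>B Z\<close> the kernel of the space derivatives\<close>
  have "(\<lambda>n. (1 + B * Z) * lip * J (real n)) \<longlonglongrightarrow> (1 + B * Z) * lip * 0"
    unfolding J_def by (intro tendsto_intros weighted_inverse_sqrt_tendsto_0)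
  then have "\<forall>\<^sub>F n in sequentially. (1 + B * Z) * lip * J (real n) < l"
    using l by (intro order_tendstoD(2)) auto
  then have "\<forall>\<^sub>F n in sequentially. (1 + B * Z) * lip * J (real n) < l \<and> 1 \<le> n"
    using eventually_ge_at_top by (rule eventually_conj)
  then obtain n :: nat where n: "(1 + B * Z) * lip * J (real n) < l" "1 \<le> n"
    by (auto simp: eventually_sequentially)
  define k where "k = real n"
  have "\<rho> k (L M \<eta> h) (L M \<eta> f) \<le> ennreal l * \<rho> k h f" if h: "h \<in> X" and f: "f \<in> X" for h f
  proof (cases "\<rho> k h f")
    \<comment> \<open>an infinite distance stays infinite after multiplication by \<open>l > 0\<close>\<close>
    case top
    then show ?thesis using l by (simp add: ennreal_mult_top)
  next
    case (real R)
    have dist: "\<bar>h x u - f x u\<bar> + \<bar>d_s h x u - d_s f x u\<bar> \<le> R * exp (k * (T - u))"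
      if "u \<in> {0..T}" for x u
    proof -
      have "ennreal (exp (- k * (T - u)) * (\<bar>f x u - h x u\<bar> + \<bar>d_s f x u - d_s h x u\<bar>)) \<le> \<rho> k h f"
        unfolding \<rho>_def using that by (intro SUP_upper2[of "(x, u)"]) auto
      then have "exp (- k * (T - u)) * (\<bar>h x u - f x u\<bar> + \<bar>d_s h x u - d_s f x u\<bar>) \<le> R"
        using real by (simp add: abs_minus_commute)
      then have "exp (k * (T - u)) * (exp (- k * (T - u)) * (\<bar>h x u - f x u\<bar> + \<bar>d_s h x u - d_s f x u\<bar>))
          \<le> exp (k * (T - u)) * R"
        by (intro mult_left_mono) auto
      then show ?thesis by (simp add: mult.assoc[symmetric] exp_add[symmetric] mult.commute)
    qed
    obtain K where Kh: "flow.bounded_cont K (reward h)" by (rule reward_bounded_cont[OF h])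
    obtain K' where Kf: "flow.bounded_cont K' (reward f)" by (rule reward_bounded_cont[OF f])
    let ?D = "\<lambda>x u. reward h x u - reward f x u"
    have Kd: "flow.bounded_cont (K + K') ?D"
      using Kh Kf unfolding flow.bounded_cont_def case_prod_beta
      by (auto intro!: continuous_intros order_trans[OF abs_triangle_ineq4] add_mono)
    have bd: "\<bar>?D x u\<bar> \<le> (lip * R) * exp (k * (T - u))" if u: "u \<in> {0..T}" for x u
    proof -
      have "\<bar>?D x u\<bar> \<le> lip * (\<bar>h x u - f x u\<bar> + \<bar>d_s h x u - d_s f x u\<bar>)"
        using \<Psi>_lipschitz[OF h f u] u by (simp add: reward_def clamp_time_id)
      also have "\<dots> \<le> lip * (R * exp (k * (T - u)))" by (intro mult_left_mono dist u lip_nonneg)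
      finally show ?thesis by (simp add: mult.assoc)
    qed
    have R: "0 \<le> lip * R" using real lip_nonneg by simp
    have "exp (- k * (T - t)) * (\<bar>L M \<eta> f s t - L M \<eta> h s t\<bar> + \<bar>d_s (L M \<eta> f) s t - d_s (L M \<eta> h) s t\<bar>)
        \<le> l * R" if t: "t \<in> {0..T}" for s t
    proof -
      have t0: "0 \<le> t" using t by simp
      have "L M \<eta> h s t - L M \<eta> f s t = flow.potential (\<lambda>_ _. 1) (\<lambda>_. 1) ?D s t"
        using t by (simp add: L_eq_potential[OF bm sde t h] L_eq_potential[OF bm sde t f]
            flow.potential_diff[OF admissible_one Kh Kf w1 t0])
      then have v: "\<bar>L M \<eta> f s t - L M \<eta> h s t\<bar> \<le> 1 * 1 * (lip * R) * exp (k * (T - t)) * J k"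
        using flow.abs_potential_le[OF admissible_one Kd w1 bd R t0, of s]
          N.prob_space by (simp add: J_def abs_minus_commute[of "L M \<eta> f s t"])
      have "d_s (L M \<eta> h) s t - d_s (L M \<eta> f) s t = flow.potential ?ratio (\<lambda>z. z) ?D s t"
        using d_s_L_eq_potential(2)[OF bm sde t h] d_s_L_eq_potential(2)[OF bm sde t f]
          flow.potential_diff[OF B Kh Kf integrable_id_std_gauss t0] by simp
      then have dv: "\<bar>d_s (L M \<eta> f) s t - d_s (L M \<eta> h) s t\<bar>
          \<le> B * Z * (lip * R) * exp (k * (T - t)) * J k"
        using flow.abs_potential_le[OF B Kd integrable_id_std_gauss bd R t0, of s]
        by (simp add: J_def Z_def abs_minus_commute)
      have "exp (- k * (T - t)) * (\<bar>L M \<eta> f s t - L M \<eta> h s t\<bar> + \<bar>d_s (L M \<eta> f) s t - d_s (L M \<eta> h) s t\<bar>)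
         \<le> exp (- k * (T - t)) * (1 * 1 * (lip * R) * exp (k * (T - t)) * J k
            + B * Z * (lip * R) * exp (k * (T - t)) * J k)"
        by (intro mult_left_mono add_mono v dv) auto
      also have "\<dots> = (exp (- k * (T - t)) * exp (k * (T - t))) * (((1 + B * Z) * lip * J k) * R)"
        by (simp only: distrib_left distrib_right mult_ac mult_1)
      also have "exp (- k * (T - t)) * exp (k * (T - t)) = 1" by (simp add: exp_add[symmetric])
      also have "1 * (((1 + B * Z) * lip * J k) * R) \<le> l * R"
        using n(1) real by (auto simp: k_def intro!: mult_right_mono)
      finally show ?thesis .
    qed
    then have "\<rho> k (L M \<eta> h) (L M \<eta> f) \<le> ennreal (l * R)"
      unfolding \<rho>_def by (intro SUP_least) (auto intro!: ennreal_leI)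
    then show ?thesis using real l by (simp add: ennreal_mult)
  qed
  moreover have "1 \<le> k" using n(2) by (simp add: k_def)
  ultimately show ?thesis by blast
qed

end

section \<open>The contraction theorem\<close>

theorem proposition6p4:
  fixes \<gamma> \<kappa> \<sigma> varpi T r :: real
    and M :: "'w measure"
    and W :: "real \<Rightarrow> 'w \<Rightarrow> real"
    and \<eta> :: "real \<Rightarrow> real \<Rightarrow> real \<Rightarrow> 'w \<Rightarrow> real"
  assumes "0 < \<gamma>" and "\<gamma> < 1" and "0 < \<kappa>" and "0 < \<sigma>" and "0 < varpi"
    and "r \<le> \<kappa>" and "0 < \<kappa> + r"
    and "0 < T" and "T < market.T\<^sub>0 \<gamma> \<kappa> \<sigma> T r"
    and "standard_brownian_motion M W"
    and "\<And>s t. 0 \<le> t \<Longrightarrow> t \<le> T \<Longrightarrow> market.solves_sde \<gamma> \<kappa> \<sigma> T r M W s t (\<eta> s t)"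
  defines "X \<equiv> market.X \<gamma> \<kappa> \<sigma> varpi T r"
    and "L \<equiv> market.L \<gamma> \<kappa> \<sigma> varpi T r M \<eta>"
  shows "(\<forall>h\<in>X. L h \<in> market.C10 T) \<and>
    (\<forall>l. 0 < l \<and> l < 1 \<longrightarrow>
      (\<exists>k\<ge>1. \<forall>h\<in>X. \<forall>f\<in>X.
        market.\<rho> T k (L h) (L f) \<le> ennreal l * market.\<rho> T k h f))"
proof -
  note defs = X_def L_def
  interpret merton_market \<gamma> \<kappa> \<sigma> varpi T r
    by unfold_locales (rule assms)+
  show ?thesis
    unfolding defs
    using L_mem_C10[OF assms(10,11)] L_contraction[OF assms(10,11)] by simp
qed

end
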